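(* For any $r$ of the form $r = 1 - \tfrac{1}{t}$ with $t \ge 2$ and any $\epsilon > 0$, any algorithm that achieves a $(1 - r + \epsilon)$-approximation for FMSM on all instances satisfying $\min_{x \in P_{\mathcal{F}} \cup (\mathbb{1} - P_{\mathcal{F}})} \|x\|_\infty \le r$ requires an exponential number of value queries. The same holds for approximating the continuous relaxation $\max_{x \in P_{\mathcal{F}}} F(x)$. Furthermore, both statements hold even restricted to each of the two special cases: (i) $C = 2$ and $\mathcal{I} = 2^V$ (no matroid constraint); (ii) $C = 1$ and $\mathcal{I}$ is a partition matroid.
   Context: An FMSM instance consists of a ground set $V$ of $n$ elements, a non-negative (not necessarily monotone) submodular function $f : 2^V \to \mathbb{R}_{\ge 0}$ accessible only through a value oracle, a matroid $\mathcal{I} \subseteq 2^V$, a partition of $V$ into color groups $V_1,\dots,V_C$, and integer bounds $0 \le \ell_c \le u_c$. Fair sets $\mathcal{C} = \{S : \ell_c \le |S \cap V_c| \le u_c\ \forall c\}$, feasible sets $\mathcal{F} = \mathcal{I} \cap \mathcal{C}$ (nonempty); the goal is $\max_{S \in \mathcal{F}} f(S)$. An $\alpha$-approximation outputs a feasible set of value at least $\alpha$ times the optimum. $P_{\mathcal{F}} = \mathrm{conv}\{\mathbb{1}_S : S \in \mathcal{F}\}$, $\mathbb{1} - P_{\mathcal{F}} = \{x \in [0,1]^n : \mathbb{1} - x \in P_{\mathcal{F}}\}$, and $F(x) = \sum_{S \subseteq V} f(S)\prod_{i\in S}x_i\prod_{j\notin S}(1-x_j)$ is the multilinear extension. A partition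 matroid: $V$ partitioned into blocks $G_i$ with bounds $k_i$, $X$ independent iff $|X \cap G_i| \le k_i$ for all $i$. *)

theory Defs
  imports "HOL-Probability.Probability"
begin

definition matroid :: "nat set \<Rightarrow> nat set set \<Rightarrow> bool" where
  "matroid V I \<longleftrightarrow> I \<subseteq> Pow V \<and> {} \<in> I \<and> (\<forall>X\<in>I. \<forall>Y. Y \<subseteq> X \<longrightarrow> Y \<in> I) \<and>
     (\<forall>X\<in>I. \<forall>Y\<in>I. card X < card Y \<longrightarrow> (\<exists>e\<in>Y - X. insert e X \<in> I))"

definition partition_matroid :: "nat set \<Rightarrow> nat set set \<Rightarrow> bool" where
  "partition_matroid V I \<longleftrightarrow> (\<exists>(blk::nat \<Rightarrow> nat) (k::nat \<Rightarrow> nat).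
      I = {X. X \<subseteq> V \<and> (\<forall>b. card {x\<in>X. blk x = b} \<le> k b)})"

definition fair_sets :: "nat set \<Rightarrow> nat \<Rightarrow> (nat \<Rightarrow> nat) \<Rightarrow> (nat \<Rightarrow> nat) \<Rightarrow> (nat \<Rightarrow> nat) \<Rightarrow> nat set set" where
  "fair_sets V C col l u = {S. S \<subseteq> V \<and>
     (\<forall>c<C. l c \<le> card {x\<in>S. col x = c} \<and> card {x\<in>S. col x = c} \<le> u c)}"

definition feasible_sets :: "nat set \<Rightarrow> nat set set \<Rightarrow> nat \<Rightarrow> (nat \<Rightarrow> nat) \<Rightarrow> (nat \<Rightarrow> nat) \<Rightarrow> (nat \<Rightarrow> nat) \<Rightarrow> nat set set" where
  "feasible_sets V I C col l u = I \<inter> fair_sets V C col l u"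

definition valid_structure :: "nat set \<Rightarrow> nat set set \<Rightarrow> nat \<Rightarrow> (nat \<Rightarrow> nat) \<Rightarrow> (nat \<Rightarrow> nat) \<Rightarrow> (nat \<Rightarrow> nat) \<Rightarrow> bool" where
  "valid_structure V I C col l u \<longleftrightarrow> matroid V I \<and> (\<forall>x\<in>V. col x < C) \<and> (\<forall>c<C. l c \<le> u c) \<and>
     feasible_sets V I C col l u \<noteq> {}"

definition nonneg_submodular :: "nat set \<Rightarrow> (nat set \<Rightarrow> real) \<Rightarrow> bool" where
  "nonneg_submodular V f \<longleftrightarrow> (\<forall>S. S \<subseteq> V \<longrightarrow> 0 \<le> f S) \<and>
     (\<forall>S T. S \<subseteq> V \<longrightarrow> T \<subseteq> V \<longrightarrow> f (S \<union> T) + f (S \<inter> T) \<le> f S + f T)"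

section \<open>Polytopes and the multilinear extension (vectors: nat \<Rightarrow> real, zero outside V)\<close>

definition indic_vec :: "nat set \<Rightarrow> nat \<Rightarrow> real" where
  "indic_vec S = (\<lambda>i. if i \<in> S then 1 else 0)"

definition polytope :: "nat set set \<Rightarrow> (nat \<Rightarrow> real) set" where
  "polytope Fs = {x. \<exists>w::nat set \<Rightarrow> real. (\<forall>S\<in>Fs. 0 \<le> w S) \<and> (\<Sum>S\<in>Fs. w S) = 1 \<and>
       x = (\<lambda>i. \<Sum>S\<in>Fs. w S * indic_vec S i)}"

definition one_minus :: "nat set \<Rightarrow> (nat \<Rightarrow> real) set \<Rightarrow> (nat \<Rightarrow> real) set" where
  "one_minus V P = {x. (\<forall>i. i \<notin> V \<longrightarrow> x i = 0) \<and> (\<lambda>i. if i \<in> V then 1 - x i else 0) \<in> P}"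

definition linf :: "nat set \<Rightarrow> (nat \<Rightarrow> real) \<Rightarrow> real" where
  "linf V x = (SUP i\<in>V. \<bar>x i\<bar>)"

definition multilinear :: "nat set \<Rightarrow> (nat set \<Rightarrow> real) \<Rightarrow> (nat \<Rightarrow> real) \<Rightarrow> real" where
  "multilinear V f x = (\<Sum>S\<in>Pow V. f S * (\<Prod>i\<in>S. x i) * (\<Prod>j\<in>V - S. 1 - x j))"

text \<open>A deterministic adaptive algorithm maps the history of (query, answer) pairs to the
  next step: another value query or a final output. A randomized algorithm is a
  probability distribution over deterministic ones.\<close>
datatype 'o step = Query "nat set" | Output 'o

type_synonym 'o algorithm = "(nat set \<times> real) list \<Rightarrow> 'o step"

fun run :: "'o algorithm \<Rightarrow> (nat set \<Rightarrow> real) \<Rightarrow> nat \<Rightarrow> (nat set \<times> real) list \<Rightarrow> 'o option" where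
  "run A g 0 h = (case A h of Output out \<Rightarrow> Some out | Query Q \<Rightarrow> None)"
| "run A g (Suc k) h = (case A h of Output out \<Rightarrow> Some out | Query Q \<Rightarrow> run A g k (h @ [(Q, g Q)]))"

definition val_oracle :: "nat set \<Rightarrow> (nat set \<Rightarrow> real) \<Rightarrow> nat set \<Rightarrow> real" where
  "val_oracle V f = (\<lambda>Q. f (Q \<inter> V))"

definition approx_disc :: "real \<Rightarrow> nat set \<Rightarrow> nat set set \<Rightarrow> (nat set \<Rightarrow> real) \<Rightarrow> nat \<Rightarrow> nat set algorithm pmf \<Rightarrow> bool" where
  "approx_disc \<alpha> V Fs f q R \<longleftrightarrow>
     (\<forall>A\<in>set_pmf R. the (run A (val_oracle V f) q []) \<in> Fs) \<and>
     \<alpha> * Max (f ` Fs) \<le> measure_pmf.expectation R (\<lambda>A. f (the (run A (val_oracle V f) q [])))"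

definition approx_cont :: "real \<Rightarrow> nat set \<Rightarrow> nat set set \<Rightarrow> (nat set \<Rightarrow> real) \<Rightarrow> nat \<Rightarrow> (nat \<Rightarrow> real) algorithm pmf \<Rightarrow> bool" where
  "approx_cont \<alpha> V Fs f q R \<longleftrightarrow>
     (\<forall>A\<in>set_pmf R. the (run A (val_oracle V f) q []) \<in> polytope Fs) \<and>
     \<alpha> * (SUP x\<in>polytope Fs. multilinear V f x)
       \<le> measure_pmf.expectation R (\<lambda>A. multilinear V f (the (run A (val_oracle V f) q [])))"

definition special_case_i :: "nat set \<Rightarrow> nat set set \<Rightarrow> nat \<Rightarrow> bool" where
  "special_case_i V I C \<longleftrightarrow> C = 2 \<and> I = Pow V"

definition special_case_ii :: "nat set \<Rightarrow> nat set set \<Rightarrow> nat \<Rightarrow> bool" where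
  "special_case_ii V I C \<longleftrightarrow> C = 1 \<and> partition_matroid V I"

text \<open>Hardness of (1 - r + eps)-approximation with exponentially many queries, on instances whose
  structure satisfies the special case Case and the condition min ||x||_inf \<le> r.
  The output type 'o together with succ selects the discrete or the continuous problem.\<close>
definition exp_hard ::
  "(nat set \<Rightarrow> nat set set \<Rightarrow> nat \<Rightarrow> bool) \<Rightarrow> real \<Rightarrow>
   (nat set \<Rightarrow> nat set set \<Rightarrow> (nat set \<Rightarrow> real) \<Rightarrow> nat \<Rightarrow> 'o algorithm pmf \<Rightarrow> bool) \<Rightarrow> bool" where
  "exp_hard Case r succ \<longleftrightarrow>
    (\<exists>c>0. \<exists>N. \<forall>n\<ge>N. \<exists>I C col l u.
       Case {..<n} I C \<and> valid_structure {..<n} I C col l u \<and>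
       (let Fs = feasible_sets {..<n} I C col l u
        in (INF x\<in>polytope Fs \<union> one_minus {..<n} (polytope Fs). linf {..<n} x) \<le> r \<and>
           (\<forall>q R. real q < exp (c * real n) \<longrightarrow>
              (\<forall>A\<in>set_pmf R. \<forall>f. nonneg_submodular {..<n} f \<longrightarrow> run A (val_oracle {..<n} f) q [] \<noteq> None) \<longrightarrow>
              (\<exists>f. nonneg_submodular {..<n} f \<and> \<not> succ {..<n} Fs f q R))))"

end

(* Symmetry gap (Vondrak). Split the ground set into sides A and B of km elements each and consider
   sets with m elements of A and (k - 1) m elements of B, where k = t. Hide parts A1 of A and B1 of B
   of size m. The directed cut A1 -> B1 plus A2 -> B2, suitably normalized, has value 1 on A1 union
   B2, but its symmetrization has value at most 1/k = 1 - r on the whole polytope. The cut can be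
   perturbed to a submodular function that coincides with the symmetrization on all sets meeting
   A1, A2 in nearly equal proportions, and B1, B2 likewise. By Hoeffding's inequality a fixed set is
   of this kind for a random hidden partition, except with exponentially small probability, so that
   subexponentially many queries reveal nothing. The same set family arises from two colors with
   tight bounds and from a partition matroid together with one tight cardinality constraint. *)
theory Submission
  imports Defs
begin

section \<open>Flattening a product near the origin\<close>

text \<open>With fractions \<open>x1\<close>, \<open>x2\<close> and \<open>y1\<close>,
  \<open>y2\<close> of the four parts chosen, the cut and its symmetrization differ by
  \<open>(k - 1) / k\<close> times \<open>u * v\<close>, where \<open>u = x1 - x2\<close> and
  \<open>v = y1 - y2\<close> are the imbalances. Hiding the partition thus means multiplying
  \<open>u * v\<close> by a weight that vanishes near the origin and is 1 at the optimum
  \<open>(1, -1)\<close>. Submodularity is the obstacle. In the cut, two elements of the same side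
  have second difference 0, and so have an element of \<open>A1\<close> and one of
  \<open>B2\<close>, since no arc joins them; at such pairs nothing is left to absorb an error of
  the weight. A small multiple of a strictly submodular function of the side sizes pays for the
  errors, and the objective values change in proportion to them. The quotas tie the gap to the norm:
  densities \<open>1 / k\<close> on one side and \<open>1 - 1 / k\<close> on the other make the
  symmetrized cut worth \<open>k * (1 / k) * (1 / k) = 1 / k\<close>, while the larger density is
  \<open>r\<close>.\<close>

lemma mvt_segment:
  fixes f f' :: "real \<Rightarrow> real"
  assumes "\<And>x. (f has_real_derivative f' x) (at x)"
  shows "\<exists>\<xi>\<in>closed_segment u (u + a). f (u + a) - f u = a * f' \<xi>"
proof -
  consider "a = 0" | "a > 0" | "a < 0" by linarith
  then show ?thesis
  proof cases
    case 2
    then obtain z where "u < z" "z < u + a" "f (u + a) - f u = (u + a - u) * f' z"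
      using MVT2[of u "u + a" f f'] assms by auto
    then show ?thesis by (intro bexI[of _ z]) (auto simp: closed_segment_eq_real_ivl)
  next
    case 3
    then obtain z where "u + a < z" "z < u" "f u - f (u + a) = (u - (u + a)) * f' z"
      using MVT2[of "u + a" u f f'] assms by auto
    then show ?thesis by (intro bexI[of _ z]) (auto simp: closed_segment_eq_real_ivl algebra_simps)
  qed auto
qed

lemma mixed_difference:
  fixes g gu guv :: "real \<Rightarrow> real \<Rightarrow> real"
  assumes g: "\<And>u v. ((\<lambda>u. g u v) has_real_derivative gu u v) (at u)"
    and gu: "\<And>u v. ((\<lambda>v. gu u v) has_real_derivative guv u v) (at v)"
  shows "\<exists>\<xi>\<in>closed_segment u (u + a). \<exists>\<eta>\<in>closed_segment v (v + b).
           g (u + a) (v + b) - g (u + a) v - g u (v + b) + g u v = a * b * guv \<xi> \<eta>"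
proof -
  have "((\<lambda>u. g u (v + b) - g u v) has_real_derivative gu u (v + b) - gu u v) (at u)" for u
    by (intro derivative_intros g)
  from mvt_segment[OF this, of u a] obtain \<xi> where \<xi>: "\<xi> \<in> closed_segment u (u + a)"
    "(g (u + a) (v + b) - g (u + a) v) - (g u (v + b) - g u v) = a * (gu \<xi> (v + b) - gu \<xi> v)"
    by auto
  obtain \<eta> where "\<eta> \<in> closed_segment v (v + b)" "gu \<xi> (v + b) - gu \<xi> v = b * guv \<xi> \<eta>"
    using mvt_segment[OF gu, of v b] by auto
  with \<xi> show ?thesis
    by (intro bexI[of _ \<xi>] bexI[of _ \<eta>]) auto
qed

text \<open>This is \<open>mixed_difference\<close> for \<open>g (u + v)\<close> as a function of
  two variables. The intermediate point \<open>\<xi> + \<eta>\<close> is a convex combination of the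
  four points where \<open>g\<close> is evaluated, hence stays in \<open>S\<close>.\<close>

lemma pure_difference:
  fixes g g' g'' :: "real \<Rightarrow> real"
  assumes g: "\<And>u. (g has_real_derivative g' u) (at u)"
    and g': "\<And>u. (g' has_real_derivative g'' u) (at u)"
    and S: "convex S" "u \<in> S" "u + a \<in> S" "u + b \<in> S" "u + a + b \<in> S"
  shows "\<exists>\<xi>\<in>S. g (u + a + b) - g (u + a) - g (u + b) + g u = a * b * g'' \<xi>"
proof -
  have "\<exists>\<xi>\<in>closed_segment u (u + a). \<exists>\<eta>\<in>closed_segment 0 (0 + b).
      g ((u + a) + (0 + b)) - g ((u + a) + 0) - g (u + (0 + b)) + g (u + 0) = a * b * g'' (\<xi> + \<eta>)"
  proof (rule mixed_difference[where g = "\<lambda>u v. g (u + v)" and gu = "\<lambda>u v. g' (u + v)"])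
    fix u v
    show "((\<lambda>u. g (u + v)) has_real_derivative g' (u + v)) (at u)"
      by (rule DERIV_shift[THEN iffD1, OF g[of "u + v"]])
    show "((\<lambda>v. g' (u + v)) has_real_derivative g'' (u + v)) (at v)"
      using DERIV_shift[THEN iffD1, OF g'[of "v + u"]] by (simp add: add.commute)
  qed
  then obtain \<xi> \<eta> where *: "\<xi> \<in> closed_segment u (u + a)" "\<eta> \<in> closed_segment 0 b"
    "g (u + a + b) - g (u + a) - g (u + b) + g u = a * b * g'' (\<xi> + \<eta>)"
    by (auto simp: add.assoc)
  then obtain s r where s: "0 \<le> s" "s \<le> 1" "\<xi> = (1 - s) * u + s * (u + a)"
    and r: "0 \<le> r" "r \<le> 1" "\<eta> = r * b"
    by (auto simp: closed_segment_def)
  have "(1 - s) * u + s * (u + a) \<in> S" "(1 - s) * (u + b) + s * (u + a + b) \<in> S"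
    using S s convexD[OF S(1), of u "u + a" "1 - s" s]
      convexD[OF S(1), of "u + b" "u + a + b" "1 - s" s] by auto
  then have "(1 - r) * ((1 - s) * u + s * (u + a)) + r * ((1 - s) * (u + b) + s * (u + a + b)) \<in> S"
    using r convexD[OF S(1), of _ _ "1 - r" r] by auto
  also have "(1 - r) * ((1 - s) * u + s * (u + a)) + r * ((1 - s) * (u + b) + s * (u + a + b)) = \<xi> + \<eta>"
    by (simp add: s r algebra_simps)
  finally show ?thesis using * by blast
qed

text \<open>Prepares a cubic ramp: from the square on, powers of the positive part have no kink at
  0, so the cube can be differentiated twice.\<close>

lemma DERIV_pos_part_power:
  "((\<lambda>z::real. max 0 z ^ Suc (Suc n)) has_real_derivative (real (n + 2) * max 0 z ^ Suc n)) (at z)"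
proof -
  consider "z > 0" | "z < 0" | "z = 0" by linarith
  then show ?thesis
  proof cases
    case 1
    have "((\<lambda>z::real. z ^ Suc (Suc n)) has_real_derivative (real (n + 2) * max 0 z ^ Suc n)) (at z)"
      using 1 by (rule_tac DERIV_cong[OF DERIV_pow]) auto
    then show ?thesis
      by (rule has_field_derivative_transform_within_open[where S = "{0<..}"]) (use 1 in auto)
  next
    case 2
    have "((\<lambda>z::real. 0) has_real_derivative (real (n + 2) * max 0 z ^ Suc n)) (at z)"
      using 2 by (auto intro!: derivative_eq_intros)
    then show ?thesis
      by (rule has_field_derivative_transform_within_open[where S = "{..<0}"]) (use 2 in auto)
  next
    case 3
    have "((\<lambda>h::real. max 0 h ^ Suc n) \<longlongrightarrow> max 0 0 ^ Suc n) (at 0)"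
      by (intro tendsto_intros)
    moreover have "\<forall>\<^sub>F h in at (0::real). max 0 h ^ Suc n = (max 0 (0 + h) ^ Suc (Suc n) - max 0 0 ^ Suc (Suc n)) / h"
      by (auto simp: eventually_at_filter max_def)
    ultimately have "((\<lambda>h::real. (max 0 (0 + h) ^ Suc (Suc n) - max 0 0 ^ Suc (Suc n)) / h) \<longlongrightarrow> 0) (at 0)"
      using tendsto_cong by fastforce
    then show ?thesis using 3 by (simp add: DERIV_def)
  qed
qed

section \<open>A ramp on a logarithmic scale and the weight built from it\<close>

text \<open>A cubic ramp over an interval of length \<open>Z\<close> has derivatives at most
  \<open>3 / Z\<close> and \<open>6 / Z^2\<close>, and \<open>Z\<close> grows without bound as
  \<open>\<gamma>\<close> shrinks. The end points are the values of
  \<open>ln (u^2 + v^2 + \<gamma>)\<close> at \<open>u^2 + v^2 = \<gamma>\<close> and at the corners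
  of the square \<open>[-1, 1]^2\<close>.\<close>

lemma exists_slow_ramp:
  fixes \<kappa> :: real
  assumes "\<kappa> > 0"
  shows "\<exists>\<gamma>>0. \<exists>P P' P'' :: real \<Rightarrow> real. (\<forall>z. (P has_real_derivative P' z) (at z)) \<and>
     (\<forall>z. (P' has_real_derivative P'' z) (at z)) \<and> P (ln (2 + \<gamma>)) = 1 \<and>
     (\<forall>z \<le> ln (2 * \<gamma>). P z = 0) \<and>
     (\<forall>z \<le> ln (2 + \<gamma>). 0 \<le> P z \<and> P z \<le> 1 \<and> 0 \<le> P' z \<and> P' z \<le> \<kappa> \<and> 0 \<le> P'' z \<and> P'' z \<le> \<kappa>)"
proof -
  \<comment> \<open>\<open>6 / \<kappa>\<close> serves both derivatives, because
    \<open>K \<ge> 1\<close> gives \<open>6 / Z^2 \<le> 6 / Z\<close>.\<close>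
  define K where "K = max 1 (6 / \<kappa>)"
  have K: "K \<ge> 1" "6 \<le> \<kappa> * K"
    using assms by (auto simp: K_def max_def field_simps)
  define \<gamma> where "\<gamma> = exp (- K)"
  define Z where "Z = ln (2 + \<gamma>) - ln (2 * \<gamma>)"
  have "\<gamma> > 0" by (simp add: \<gamma>_def)
  have "ln 2 \<le> ln (2 + \<gamma>)" using \<open>\<gamma> > 0\<close> by simp
  moreover have "Z = ln (2 + \<gamma>) - (ln 2 + ln \<gamma>)" "ln \<gamma> = - K"
    using \<open>\<gamma> > 0\<close> by (simp_all add: Z_def ln_mult) (simp add: \<gamma>_def)
  ultimately have "K \<le> Z" by linarith
  with K have Z: "Z \<ge> 1" "6 \<le> \<kappa> * Z"
    using assms by (auto intro: order.trans mult_left_mono)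
  then have Z0: "Z > 0" by simp
  have Z2: "6 / Z\<^sup>2 \<le> \<kappa>" "3 / Z \<le> \<kappa>"
  proof -
    have "\<kappa> * Z * 1 \<le> \<kappa> * Z * Z" using Z assms by (intro mult_left_mono) auto
    then show "6 / Z\<^sup>2 \<le> \<kappa>" using Z by (simp add: divide_simps power2_eq_square mult.assoc)
    show "3 / Z \<le> \<kappa>" using Z by (simp add: divide_simps)
  qed
  define q where "q = (\<lambda>z. max 0 ((z - ln (2 * \<gamma>)) / Z))"
  have q: "0 \<le> q z" for z by (simp add: q_def)
  have q1: "q z \<le> 1" if "z \<le> ln (2 + \<gamma>)" for z
    using that Z0 by (simp add: q_def Z_def[symmetric] divide_simps) (simp add: Z_def)
  have lin: "((\<lambda>z. (z - ln (2 * \<gamma>)) / Z) has_real_derivative 1 / Z) (at z)" for z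
    using Z0 by (auto intro!: derivative_eq_intros)
  have d1: "((\<lambda>z. q z ^ 3) has_real_derivative 3 / Z * q z ^ 2) (at z)" for z
    using DERIV_chain2[OF DERIV_pos_part_power[of 1] lin]
    by (simp add: q_def numeral_eq_Suc)
  have d2: "((\<lambda>z. 3 / Z * q z ^ 2) has_real_derivative 6 / Z\<^sup>2 * q z) (at z)" for z
  proof -
    have "((\<lambda>z. q z ^ 2) has_real_derivative 2 / Z * q z) (at z)"
      using DERIV_chain2[OF DERIV_pos_part_power[of 0] lin]
      by (simp add: q_def numeral_eq_Suc)
    from DERIV_cmult[OF this, of "3 / Z"] show ?thesis
      by (simp add: power2_eq_square)
  qed
  have v1: "q (ln (2 + \<gamma>)) ^ 3 = 1"
    using Z0 by (simp add: q_def Z_def[symmetric])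
  have v0: "q z ^ 3 = 0" if "z \<le> ln (2 * \<gamma>)" for z
    using that Z0 by (simp add: q_def max_def divide_simps)
  have bounds: "0 \<le> q z ^ 3" "q z ^ 3 \<le> 1" "0 \<le> 3 / Z * q z ^ 2" "3 / Z * q z ^ 2 \<le> \<kappa>"
      "0 \<le> 6 / Z\<^sup>2 * q z" "6 / Z\<^sup>2 * q z \<le> \<kappa>" if "z \<le> ln (2 + \<gamma>)" for z
  proof -
    have "3 / Z * q z ^ 2 \<le> 3 / Z * 1" "6 / Z\<^sup>2 * q z \<le> 6 / Z\<^sup>2 * 1"
      using q[of z] q1[OF that] Z0 by (intro mult_left_mono; simp add: power_le_one)+
    with Z2 show "3 / Z * q z ^ 2 \<le> \<kappa>" "6 / Z\<^sup>2 * q z \<le> \<kappa>" by linarith+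
  qed (use q[of z] q1[OF that] Z0 in \<open>simp_all add: power_le_one\<close>)
  show ?thesis
    by (intro exI[of _ \<gamma>] exI[of _ "\<lambda>z. q z ^ 3"] exI[of _ "\<lambda>z. 3 / Z * q z ^ 2"]
         exI[of _ "\<lambda>z. 6 / Z\<^sup>2 * q z"] conjI allI impI)
       (rule \<open>\<gamma> > 0\<close> d1 d2 v1 | (rule v0 bounds, assumption))+
qed

text \<open>\<open>u * v * w u v\<close> is the product \<open>u * v\<close> flattened to zero near the origin, at a cost
  of \<open>\<kappa>\<close> in its second differences. A function without pure second differences is bilinear, so
  the product can only be flattened slowly, on a logarithmic scale of \<open>u\<^sup>2 + v\<^sup>2\<close>.\<close>
definition flat_weight :: "real \<Rightarrow> real \<Rightarrow> (real \<Rightarrow> real \<Rightarrow> real) \<Rightarrow> bool" where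
  "flat_weight \<kappa> \<gamma> w \<longleftrightarrow>
     (\<forall>u\<in>{-1..1}. \<forall>v\<in>{-1..1}. 0 \<le> w u v \<and> w u v \<le> 1) \<and>
     (\<forall>u v. u\<^sup>2 + v\<^sup>2 \<le> \<gamma> \<longrightarrow> w u v = 0) \<and>
     (\<forall>u v. w u v = w v u) \<and>
     (\<forall>u a b v. {u, u + a, u + b, u + a + b, v} \<subseteq> {-1..1} \<longrightarrow>
       (\<exists>c. \<bar>c\<bar> \<le> \<kappa> \<and> (u + a + b) * v * w (u + a + b) v - (u + a) * v * w (u + a) v
          - (u + b) * v * w (u + b) v + u * v * w u v = a * b * c)) \<and>
     (\<forall>u a v b. {u, u + a, v, v + b} \<subseteq> {-1..1} \<longrightarrow>
       (\<exists>c. 0 \<le> c \<and> c \<le> 1 + \<kappa> \<and> (u + a) * (v + b) * w (u + a) (v + b) - (u + a) * v * w (u + a) v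
          - u * (v + b) * w u (v + b) + u * v * w u v = a * b * c))"

text \<open>Each derivative of the logarithm costs a factor of order one over the radius, which the
  factor \<open>u * v\<close> makes up for. So the second derivatives are combinations of
  \<open>P\<close>, \<open>P'\<close> and \<open>P''\<close> with bounded coefficients, and
  \<open>P\<close> itself, the only term that is not small, occurs in the mixed derivative
  alone.\<close>

lemma exists_flat_weight:
  assumes "\<kappa> > 0"
  shows "\<exists>\<gamma>>0. \<exists>w. flat_weight \<kappa> \<gamma> w \<and> w 1 (-1) = 1"
proof -
  \<comment> \<open>The 5 comes from \<open>guu\<close>, which is bounded by
    \<open>1 / 2 * (6 + 4)\<close> times the common bound on \<open>P'\<close> and
    \<open>P''\<close>.\<close>
  obtain \<gamma> P P' P'' where "\<gamma> > 0"
    and P: "\<And>z. (P has_real_derivative P' z) (at z)" "\<And>z. (P' has_real_derivative P'' z) (at z)"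
      "P (ln (2 + \<gamma>)) = 1" "\<And>z. z \<le> ln (2 * \<gamma>) \<Longrightarrow> P z = 0"
    and bd: "\<And>z. z \<le> ln (2 + \<gamma>) \<Longrightarrow>
      0 \<le> P z \<and> P z \<le> 1 \<and> 0 \<le> P' z \<and> P' z \<le> \<kappa> / 5 \<and> 0 \<le> P'' z \<and> P'' z \<le> \<kappa> / 5"
    using exists_slow_ramp[of "\<kappa> / 5"] assms by auto
  text \<open>The shift by \<open>\<gamma>\<close> keeps the logarithm smooth at the origin.\<close>
  define D where "D = (\<lambda>u v :: real. u\<^sup>2 + v\<^sup>2 + \<gamma>)"
  have D: "D u v > 0" for u v using \<open>\<gamma> > 0\<close> by (simp add: D_def add_nonneg_pos)
  define L where "L = (\<lambda>u v. ln (D u v))"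
  define w where "w = (\<lambda>u v. P (L u v))"
  define gu where "gu = (\<lambda>u v. v * (P (L u v) + 2 * u\<^sup>2 / D u v * P' (L u v)))"
  define guu where "guu = (\<lambda>u v. u * v / D u v * (6 * P' (L u v) + 4 * (u\<^sup>2 / D u v) * (P'' (L u v) - P' (L u v))))"
  define guv where "guv = (\<lambda>u v. P (L u v) + 2 * ((u\<^sup>2 + v\<^sup>2) / D u v) * P' (L u v)
     + 4 * ((u\<^sup>2 / D u v) * (v\<^sup>2 / D u v)) * (P'' (L u v) - P' (L u v)))"
  have Lu: "((\<lambda>u. L u v) has_real_derivative 2 * u / D u v) (at u)" for u v
    using D[of u v] unfolding L_def D_def by (auto intro!: derivative_eq_intros)
  have Lv: "((\<lambda>v. L u v) has_real_derivative 2 * v / D u v) (at v)" for u v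
    using D[of u v] unfolding L_def D_def by (auto intro!: derivative_eq_intros)
  have Du: "((\<lambda>u. D u v) has_real_derivative 2 * u) (at u)" for u v
    unfolding D_def by (auto intro!: derivative_eq_intros)
  have Dv: "((\<lambda>v. D u v) has_real_derivative 2 * v) (at v)" for u v
    unfolding D_def by (auto intro!: derivative_eq_intros)
  have D0: "D u v \<noteq> 0" for u v using D[of u v] by simp
  have g: "((\<lambda>u. u * v * w u v) has_real_derivative gu u v) (at u)" for u v
    unfolding w_def gu_def using D0[of u v]
    by (auto intro!: derivative_eq_intros DERIV_chain2[OF P(1) Lu] simp: field_simps power2_eq_square)
  have guu: "((\<lambda>u. gu u v) has_real_derivative guu u v) (at u)" for u v
    unfolding gu_def guu_def using D0[of u v]
    by (auto intro!: derivative_eq_intros DERIV_chain2[OF P(1) Lu] DERIV_chain2[OF P(2) Lu] Du)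
       (simp add: field_simps power2_eq_square)
  have guv: "((\<lambda>v. gu u v) has_real_derivative guv u v) (at v)" for u v
    unfolding gu_def guv_def using D0[of u v]
    by (auto intro!: derivative_eq_intros DERIV_chain2[OF P(1) Lv] DERIV_chain2[OF P(2) Lv] Dv)
       (simp add: field_simps power2_eq_square)
  have bounds: "\<bar>guu u v\<bar> \<le> \<kappa>" "0 \<le> guv u v" "guv u v \<le> 1 + \<kappa>" "0 \<le> w u v" "w u v \<le> 1"
    if "u \<in> {-1..1}" "v \<in> {-1..1}" for u v
  proof -
    have "u\<^sup>2 \<le> 1" "v\<^sup>2 \<le> 1"
      using that by (auto simp: abs_square_le_1)
    then have "L u v \<le> ln (2 + \<gamma>)"
      unfolding L_def using D[of u v] \<open>\<gamma> > 0\<close> by (subst ln_le_cancel_iff) (auto simp: D_def)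
    note bd[OF this]
    then have b: "0 \<le> P (L u v)" "P (L u v) \<le> 1" "0 \<le> P' (L u v)" "P' (L u v) \<le> \<kappa> / 5"
      "0 \<le> P'' (L u v)" "P'' (L u v) \<le> \<kappa> / 5" by blast+
    show "0 \<le> w u v" "w u v \<le> 1" using b by (auto simp: w_def)
    define p where "p = u\<^sup>2 / D u v"
    define q where "q = v\<^sup>2 / D u v"
    have pq: "0 \<le> p" "0 \<le> q" "p + q \<le> 1"
      using D[of u v] \<open>\<gamma> > 0\<close> by (auto simp: p_def q_def add_divide_distrib[symmetric] D_def)
    \<comment> \<open>\<open>4 p q \<le> (p + q)^2 \<le> p + q\<close> keeps the coefficient of
      \<open>P'\<close> in \<open>guv\<close> nonnegative.\<close>
    have "0 \<le> (p - q)\<^sup>2" "(p + q)\<^sup>2 \<le> (p + q) * 1"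
      using pq mult_left_mono[of "p + q" 1 "p + q"] by (auto simp: power2_eq_square)
    then have 4: "4 * (p * q) \<le> p + q" "0 \<le> p * q" using pq by (auto simp: power2_eq_square algebra_simps)
    have "2 * \<bar>u * v\<bar> \<le> u\<^sup>2 + v\<^sup>2"
      using sum_squares_bound[of "\<bar>u\<bar>" "\<bar>v\<bar>"] by (simp add: abs_mult)
    then have r: "\<bar>u * v / D u v\<bar> \<le> 1 / 2"
      using D[of u v] \<open>\<gamma> > 0\<close> by (simp add: D_def field_simps abs_mult)
    have "\<bar>6 * P' (L u v) + 4 * p * (P'' (L u v) - P' (L u v))\<bar> \<le> 2 * \<kappa>"
    proof -
      have "\<bar>4 * p * (P'' (L u v) - P' (L u v))\<bar> \<le> 4 * 1 * (\<kappa> / 5)"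
      proof -
        have "\<bar>P'' (L u v) - P' (L u v)\<bar> \<le> \<kappa> / 5" using b by linarith
        then show ?thesis unfolding abs_mult using pq by (intro mult_mono) auto
      qed
      moreover have "\<bar>6 * P' (L u v)\<bar> \<le> 6 * (\<kappa> / 5)" using b by simp
      ultimately show ?thesis by linarith
    qed
    with r have "\<bar>guu u v\<bar> \<le> 1 / 2 * (2 * \<kappa>)"
      unfolding guu_def p_def[symmetric] abs_mult[of "u * v / D u v"] by (intro mult_mono) auto
    then show "\<bar>guu u v\<bar> \<le> \<kappa>" by simp
    have e: "guv u v = P (L u v) + (2 * (p + q) - 4 * (p * q)) * P' (L u v) + 4 * (p * q) * P'' (L u v)"
      by (simp add: guv_def p_def q_def add_divide_distrib diff_divide_distrib algebra_simps)
    show "0 \<le> guv u v" unfolding e using b 4 pq by (intro add_nonneg_nonneg mult_nonneg_nonneg) auto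
    have "2 * (p + q) - 4 * (p * q) \<le> 2" using 4(2) pq(3) by simp
    moreover have "4 * (p * q) \<le> 1" using 4(1) pq(3) by (rule order.trans)
    ultimately have "(2 * (p + q) - 4 * (p * q)) * P' (L u v) \<le> 2 * (\<kappa> / 5)"
         "4 * (p * q) * P'' (L u v) \<le> 1 * (\<kappa> / 5)"
      by - (rule mult_mono[OF _ b(4) _ b(3)] mult_mono[OF _ b(6) _ b(5)]; (assumption | simp))+
    with b assms show "guv u v \<le> 1 + \<kappa>" unfolding e by linarith
  qed
  have sym: "w u v = w v u" for u v by (simp add: w_def L_def D_def add.commute)
  have zero: "w u v = 0" if "u\<^sup>2 + v\<^sup>2 \<le> \<gamma>" for u v
    using that D[of u v] \<open>\<gamma> > 0\<close> by (auto simp: w_def L_def D_def intro!: P(4))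
  have "flat_weight \<kappa> \<gamma> w"
    unfolding flat_weight_def
  proof (intro conjI allI impI ballI, goal_cases)
    case (5 u a b v)
    then have "\<exists>\<xi>\<in>{-1..1}. (u + a + b) * v * w (u + a + b) v - (u + a) * v * w (u + a) v
          - (u + b) * v * w (u + b) v + u * v * w u v = a * b * guu \<xi> v"
      by (intro pure_difference[where g' = "\<lambda>u. gu u v"] g guu) auto
    then obtain \<xi> where "\<xi> \<in> {-1..1}" "(u + a + b) * v * w (u + a + b) v - (u + a) * v * w (u + a) v
          - (u + b) * v * w (u + b) v + u * v * w u v = a * b * guu \<xi> v" by blast
    moreover from this(1) have "\<bar>guu \<xi> v\<bar> \<le> \<kappa>" using 5 by (intro bounds) auto
    ultimately show ?case by blast
  next
    case (6 u a v b)
    have "\<exists>\<xi>\<in>closed_segment u (u + a). \<exists>\<eta>\<in>closed_segment v (v + b).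
        (u + a) * (v + b) * w (u + a) (v + b) - (u + a) * v * w (u + a) v
          - u * (v + b) * w u (v + b) + u * v * w u v = a * b * guv \<xi> \<eta>"
      by (rule mixed_difference[where gu = gu, OF g guv])
    then obtain \<xi> \<eta> where "\<xi> \<in> closed_segment u (u + a)" "\<eta> \<in> closed_segment v (v + b)"
      "(u + a) * (v + b) * w (u + a) (v + b) - (u + a) * v * w (u + a) v
          - u * (v + b) * w u (v + b) + u * v * w u v = a * b * guv \<xi> \<eta>" by blast
    moreover from this(1,2) have "\<xi> \<in> {-1..1}" "\<eta> \<in> {-1..1}"
      using 6 by (auto simp: closed_segment_eq_real_ivl split: if_splits)
    ultimately show ?case using bounds by blast
  next
    case 4
    show ?case by (rule sym)
  qed (use bounds zero in blast)+
  moreover have "w 1 (-1) = 1" using P(3) by (simp add: w_def L_def D_def)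
  ultimately show ?thesis using \<open>\<gamma> > 0\<close> by blast
qed

section \<open>Cuts with a hidden partition\<close>

text \<open>The pairwise inequality telescopes twice: over the elements of a larger context
  \<open>D\<close>, then over the elements of the added set \<open>Y\<close>. The claim is the case
  of context \<open>S \<inter> T\<close> enlarged by \<open>S - T\<close>, with \<open>T - S\<close>
  added.\<close>

lemma submodular_if_local:
  fixes f :: "'a set \<Rightarrow> real"
  assumes "finite V"
    and local: "\<And>S x y. S \<subseteq> V \<Longrightarrow> x \<in> V - S \<Longrightarrow> y \<in> V - S \<Longrightarrow> x \<noteq> y \<Longrightarrow>
      f (insert x (insert y S)) + f S \<le> f (insert x S) + f (insert y S)"
    and "S \<subseteq> V" "T \<subseteq> V"
  shows "f (S \<union> T) + f (S \<inter> T) \<le> f S + f T"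
proof -
  have add: "f (insert x (X \<union> D)) - f (X \<union> D) \<le> f (insert x X) - f X"
    if "finite D" "X \<union> D \<subseteq> V" "x \<in> V - (X \<union> D)" for X D x
    using that
  proof (induction D rule: finite_induct)
    case (insert d D)
    show ?case
    proof (cases "d \<in> X \<union> D")
      case True
      then show ?thesis using insert by (auto simp: insert_absorb)
    next
      case False
      have "f (insert x (insert d (X \<union> D))) + f (X \<union> D) \<le> f (insert x (X \<union> D)) + f (insert d (X \<union> D))"
        using insert.prems False by (intro local) auto
      with insert show ?thesis by auto
    qed
  qed simp
  have "f (X \<union> D \<union> Y) - f (X \<union> D) \<le> f (X \<union> Y) - f X"
    if "finite Y" "finite D" "X \<union> D \<union> Y \<subseteq> V" "D \<inter> Y = {}" for X D Y
    using that
  proof (induction Y rule: finite_induct)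
    case (insert y Y)
    show ?case
    proof (cases "y \<in> X \<union> Y")
      case True
      then show ?thesis using insert by (auto simp: insert_absorb)
    next
      case False
      have "f (insert y ((X \<union> Y) \<union> D)) - f ((X \<union> Y) \<union> D) \<le> f (insert y (X \<union> Y)) - f (X \<union> Y)"
        using insert.prems insert.hyps False by (intro add) auto
      moreover have "(X \<union> Y) \<union> D = X \<union> D \<union> Y" by auto
      ultimately show ?thesis using insert by auto
    qed
  qed simp
  note diminishing = this
  have "f (S \<inter> T \<union> (S - T) \<union> (T - S)) - f (S \<inter> T \<union> (S - T)) \<le> f (S \<inter> T \<union> (T - S)) - f (S \<inter> T)"
    using assms by (intro diminishing) (auto intro: finite_subset[OF _ assms(1)])
  moreover have "S \<inter> T \<union> (S - T) \<union> (T - S) = S \<union> T" "S \<inter> T \<union> (S - T) = S" "S \<inter> T \<union> (T - S) = T"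
    by auto
  ultimately show ?thesis by simp
qed

section \<open>Objectives in terms of fill ratios and imbalances\<close>

definition fill_ratio :: "nat \<Rightarrow> nat \<Rightarrow> nat set \<Rightarrow> nat set \<Rightarrow> real" where
  "fill_ratio k m P S = real (card (S \<inter> P)) / (real k * real m)"

text \<open>The two denominators are the sizes of the parts, so this is a difference of filled
  fractions. Beyond the totals on the two sides, it is all that the objective sees of the hidden
  partition.\<close>

definition imbalance :: "nat \<Rightarrow> nat \<Rightarrow> nat set \<Rightarrow> nat set \<Rightarrow> nat set \<Rightarrow> real" where
  "imbalance k m P Q S = real (card (S \<inter> P)) / real m - real (card (S \<inter> Q)) / ((real k - 1) * real m)"

text \<open>With parts \<open>P\<close>, \<open>Q\<close> on both sides filled to fractions \<open>x1\<close>, \<open>x2\<close> and \<open>y1\<close>, \<open>y2\<close>, the choice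
  \<open>w = 1\<close> gives the directed cut \<open>x1 (1 - y1) + (k - 1) x2 (1 - y2)\<close>, and \<open>w = 0\<close> its symmetrization.
  The last term restores the submodularity lost to a flat weight.\<close>
definition cut_value :: "real \<Rightarrow> real \<Rightarrow> (real \<Rightarrow> real \<Rightarrow> real) \<Rightarrow> real \<Rightarrow> real \<Rightarrow> real \<Rightarrow> real \<Rightarrow> real" where
  "cut_value k \<rho> w X Y u v = k * X * (1 - Y) - (k - 1) / k * (u * v * w u v) + \<rho> * (4 - (X + Y)\<^sup>2)"

text \<open>Both elements lie on the same side. The term \<open>k * X * (1 - Y)\<close> is affine in
  each variable and contributes nothing, the flattened product at most
  \<open>\<bar>a * b\<bar> * \<kappa>\<close>, and the square \<open>- 2 * \<rho> * (x * y)\<close>.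
  The second form, for the other side, follows from the symmetry of \<open>w\<close>.\<close>

lemma cut_value_pure:
  assumes w: "flat_weight \<kappa> \<gamma> w" and in_range: "{u, u + a, u + b, u + a + b, v} \<subseteq> {-1..1}"
    and "k \<ge> 1" "\<bar>a * b\<bar> * \<kappa> \<le> 2 * \<rho> * (x * y)"
  shows "cut_value k \<rho> w (X + x + y) Y (u + a + b) v + cut_value k \<rho> w X Y u v
     \<le> cut_value k \<rho> w (X + x) Y (u + a) v + cut_value k \<rho> w (X + y) Y (u + b) v" (is ?A)
    and "cut_value k \<rho> w Y (X + x + y) v (u + a + b) + cut_value k \<rho> w Y X v u
     \<le> cut_value k \<rho> w Y (X + x) v (u + a) + cut_value k \<rho> w Y (X + y) v (u + b)" (is ?B)
proof -
  obtain c where c: "\<bar>c\<bar> \<le> \<kappa>" "(u + a + b) * v * w (u + a + b) v - (u + a) * v * w (u + a) v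
          - (u + b) * v * w (u + b) v + u * v * w u v = a * b * c"
    using w in_range unfolding flat_weight_def by blast
  have "\<bar>(k - 1) / k * (a * b * c)\<bar> \<le> 1 * (\<bar>a * b\<bar> * \<kappa>)"
    unfolding abs_mult using c assms by (intro mult_mono) (auto simp: divide_simps)
  with assms have *: "- ((k - 1) / k * (a * b * c)) \<le> 2 * \<rho> * (x * y)" by linarith
  have "cut_value k \<rho> w (X + x + y) Y (u + a + b) v + cut_value k \<rho> w X Y u v
     - cut_value k \<rho> w (X + x) Y (u + a) v - cut_value k \<rho> w (X + y) Y (u + b) v
     = - 2 * \<rho> * (x * y) - (k - 1) / k * (a * b * c)"
    unfolding cut_value_def c(2)[symmetric] by (simp add: algebra_simps power2_eq_square)
  with * show ?A by linarith
  have sym: "w v u = w u v" for u v using w unfolding flat_weight_def by blast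
  have "cut_value k \<rho> w Y (X + x + y) v (u + a + b) + cut_value k \<rho> w Y X v u
     - cut_value k \<rho> w Y (X + x) v (u + a) - cut_value k \<rho> w Y (X + y) v (u + b)
     = - 2 * \<rho> * (x * y) - (k - 1) / k * (a * b * c)"
    unfolding cut_value_def c(2)[symmetric] sym[of v] by (simp add: algebra_simps power2_eq_square)
  with * show ?B by linarith
qed

text \<open>One element on each side. Since the mixed difference quotient \<open>c\<close> is
  nonnegative, the flattened product helps when \<open>a * b \<ge> 0\<close>; otherwise its loss, at
  most a factor \<open>1 + \<kappa>\<close> above that of the exact cut, is covered by
  \<open>k * (x * y)\<close> together with the square.\<close>

lemma cut_value_mixed:
  assumes w: "flat_weight \<kappa> \<gamma> w" and in_range: "{u, u + a, v, v + b} \<subseteq> {-1..1}"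
    and "k \<ge> 1" "0 \<le> (k + 2 * \<rho>) * (x * y)"
    and ab: "- ((k - 1) / k * (a * b) * (1 + \<kappa>)) \<le> (k + 2 * \<rho>) * (x * y)"
  shows "cut_value k \<rho> w (X + x) (Y + y) (u + a) (v + b) + cut_value k \<rho> w X Y u v
     \<le> cut_value k \<rho> w (X + x) Y (u + a) v + cut_value k \<rho> w X (Y + y) u (v + b)"
proof -
  obtain c where c: "0 \<le> c" "c \<le> 1 + \<kappa>"
      "(u + a) * (v + b) * w (u + a) (v + b) - (u + a) * v * w (u + a) v
          - u * (v + b) * w u (v + b) + u * v * w u v = a * b * c"
    using w in_range unfolding flat_weight_def by blast
  have "- ((k - 1) / k * (a * b) * c) \<le> (k + 2 * \<rho>) * (x * y)"
  proof (cases "a * b \<ge> 0")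
    case True
    then have "0 \<le> (k - 1) / k * (a * b) * c"
      using mult_nonneg_nonneg[OF mult_nonneg_nonneg[OF _ True] c(1), of "(k - 1) / k"] assms(3) by simp
    with assms show ?thesis by linarith
  next
    case False
    then have "(k - 1) / k * (- (a * b)) * c \<le> (k - 1) / k * (- (a * b)) * (1 + \<kappa>)"
      using assms(3) c by (intro mult_left_mono mult_nonneg_nonneg) auto
    with ab show ?thesis by simp
  qed
  moreover have "cut_value k \<rho> w (X + x) (Y + y) (u + a) (v + b) + cut_value k \<rho> w X Y u v
     - cut_value k \<rho> w (X + x) Y (u + a) v - cut_value k \<rho> w X (Y + y) u (v + b)
     = - ((k + 2 * \<rho>) * (x * y)) - (k - 1) / k * (a * b * c)"
    unfolding cut_value_def c(3)[symmetric] by (simp add: algebra_simps power2_eq_square)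
  ultimately show ?thesis by (simp add: algebra_simps)
qed

definition hidden_cut :: "nat \<Rightarrow> nat \<Rightarrow> real \<Rightarrow> (real \<Rightarrow> real \<Rightarrow> real) \<Rightarrow>
    nat set \<Rightarrow> nat set \<Rightarrow> nat set \<Rightarrow> nat set \<Rightarrow> nat set \<Rightarrow> real" where
  "hidden_cut k m \<rho> w A1 A2 B1 B2 S = cut_value (real k) \<rho> w
     (fill_ratio k m (A1 \<union> A2) S) (fill_ratio k m (B1 \<union> B2) S) (imbalance k m A1 A2 S) (imbalance k m B1 B2 S)"

text \<open>The parts need not cover \<open>V\<close>, so that ground sets of every size fit;
  elements outside them leave the objective unchanged.\<close>

locale hidden_partition =
  fixes V A1 A2 B1 B2 :: "nat set" and k m :: nat
  assumes fin: "finite V" and sub: "A1 \<union> A2 \<union> B1 \<union> B2 \<subseteq> V"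
    and disj: "A1 \<inter> A2 = {}" "B1 \<inter> B2 = {}" "(A1 \<union> A2) \<inter> (B1 \<union> B2) = {}"
    and card: "card A1 = m" "card A2 = (k - 1) * m" "card B1 = m" "card B2 = (k - 1) * m"
    and k: "k \<ge> 2" and m: "m \<ge> 1"
begin

lemma finites [simp]: "finite A1" "finite A2" "finite B1" "finite B2"
  using fin sub by (auto intro: finite_subset)

lemma real_k: "real (k - 1) = real k - 1" using k by (simp add: of_nat_diff)

lemma fractions:
  fixes P Q :: "nat set"
  assumes "finite P" "finite Q" "card P = m" "card Q = (k - 1) * m" "P \<inter> Q = {}"
  obtains x y where "0 \<le> x" "x \<le> 1" "0 \<le> y" "y \<le> 1" "imbalance k m P Q S = x - y"
    "fill_ratio k m (P \<union> Q) S = (x + (real k - 1) * y) / real k"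
proof
  have "card (S \<inter> P) \<le> m" "card (S \<inter> Q) \<le> (k - 1) * m"
    using card_mono[of P "S \<inter> P"] card_mono[of Q "S \<inter> Q"] assms by auto
  then have "real (card (S \<inter> P)) \<le> real m" "real (card (S \<inter> Q)) \<le> real ((k - 1) * m)"
    by (simp_all only: of_nat_le_iff)
  then show "real (card (S \<inter> P)) / m \<le> 1" "real (card (S \<inter> Q)) / ((real k - 1) * m) \<le> 1"
    using m k by (auto simp: divide_simps real_k)
  have "card (S \<inter> (P \<union> Q)) = card (S \<inter> P) + card (S \<inter> Q)"
    using assms by (subst card_Un_disjoint[symmetric]) (auto intro: arg_cong[where f = card])
  then show "fill_ratio k m (P \<union> Q) S = (real (card (S \<inter> P)) / m +
      (real k - 1) * (real (card (S \<inter> Q)) / ((real k - 1) * m))) / real k"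
    using k m by (simp add: fill_ratio_def add_divide_distrib mult.commute)
qed (use k in \<open>auto simp: imbalance_def\<close>)

lemma fractions_A:
  obtains x y where "0 \<le> x" "x \<le> 1" "0 \<le> y" "y \<le> 1" "imbalance k m A1 A2 S = x - y"
    "fill_ratio k m (A1 \<union> A2) S = (x + (real k - 1) * y) / real k"
  using fractions[of A1 A2] disj card by auto

lemma fractions_B:
  obtains x y where "0 \<le> x" "x \<le> 1" "0 \<le> y" "y \<le> 1" "imbalance k m B1 B2 S = x - y"
    "fill_ratio k m (B1 \<union> B2) S = (x + (real k - 1) * y) / real k"
  using fractions[of B1 B2] disj card by auto

lemma imbalance_range: "imbalance k m A1 A2 S \<in> {-1..1}" "imbalance k m B1 B2 S \<in> {-1..1}"
  by (rule fractions_A[of S], simp, rule fractions_B[of S], simp)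

lemma average_range:
  assumes "0 \<le> x" "x \<le> 1" "0 \<le> y" "y \<le> (1::real)"
  shows "0 \<le> (x + (real k - 1) * y) / real k" "(x + (real k - 1) * y) / real k \<le> 1"
proof -
  have "(real k - 1) * y \<le> (real k - 1) * 1" using assms k by (intro mult_left_mono) auto
  with mult_1_right[of "real k - 1"] have "x + (real k - 1) * y \<le> 1 + (real k - 1)" using assms by linarith
  then show "(x + (real k - 1) * y) / real k \<le> 1" using k by simp
qed (use assms k in auto)

text \<open>The weight \<open>q\<close> interpolates between the symmetrized cut and the cut itself.
  Both lie between 0 and \<open>k\<close>, and \<open>X + Y \<le> 2\<close> puts the correction
  between 0 and \<open>4 * \<rho>\<close>, which is where the 4 in \<open>cut_value\<close> comes
  from.\<close>

lemma hidden_cut_bounds: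
  assumes w: "flat_weight \<kappa> \<gamma> w" and "\<rho> \<ge> 0"
  shows "0 \<le> hidden_cut k m \<rho> w A1 A2 B1 B2 S"
    and "hidden_cut k m \<rho> w A1 A2 B1 B2 S \<le> real k + 4 * \<rho>"
proof -
  obtain x1 x2 where x: "0 \<le> x1" "x1 \<le> 1" "0 \<le> x2" "x2 \<le> 1" "imbalance k m A1 A2 S = x1 - x2"
    "fill_ratio k m (A1 \<union> A2) S = (x1 + (real k - 1) * x2) / real k" (is "_ = ?X") using fractions_A .
  obtain y1 y2 where y: "0 \<le> y1" "y1 \<le> 1" "0 \<le> y2" "y2 \<le> 1" "imbalance k m B1 B2 S = y1 - y2"
    "fill_ratio k m (B1 \<union> B2) S = (y1 + (real k - 1) * y2) / real k" (is "_ = ?Y") using fractions_B .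
  note X = average_range[OF x(1-4)] and Y = average_range[OF y(1-4)]
  define q where "q = w (x1 - x2) (y1 - y2)"
  have q: "0 \<le> q" "q \<le> 1"
    using w x y by (auto simp: flat_weight_def q_def)
  have c: "real k * ?X * (1 - ?Y) - (real k - 1) / real k * ((x1 - x2) * (y1 - y2))
      = x1 * (1 - y1) + (real k - 1) * (x2 * (1 - y2))" (is "_ = ?c")
    using k by (simp add: field_simps)
  have eq: "hidden_cut k m \<rho> w A1 A2 B1 B2 S
      = (1 - q) * (real k * ?X * (1 - ?Y)) + q * ?c + \<rho> * (4 - (?X + ?Y)\<^sup>2)"
  proof -
    define G where "G = real k * ?X * (1 - ?Y)"
    define M where "M = (real k - 1) / real k * ((x1 - x2) * (y1 - y2))"
    have "?c = G - M" unfolding c[symmetric] G_def M_def ..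
    moreover have "hidden_cut k m \<rho> w A1 A2 B1 B2 S = G - M * q + \<rho> * (4 - (?X + ?Y)\<^sup>2)"
      unfolding hidden_cut_def cut_value_def x y q_def[symmetric] G_def M_def by simp
    moreover have "G' - M' * q + R = (1 - q) * G' + q * C + R" if "C = G' - M'" for C G' M' R
      unfolding that by (simp add: algebra_simps)
    ultimately show ?thesis unfolding G_def[symmetric] by metis
  qed
  have "?X * (1 - ?Y) \<le> 1 * 1" using X Y by (intro mult_mono) auto
  moreover have "0 \<le> ?X * (1 - ?Y)" using X Y by (intro mult_nonneg_nonneg) linarith+
  ultimately have g: "0 \<le> real k * ?X * (1 - ?Y)" "real k * ?X * (1 - ?Y) \<le> k"
    using mult_left_mono[of "?X * (1 - ?Y)" 1 "real k"] mult_left_mono[of 0 "?X * (1 - ?Y)" "real k"]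
    unfolding mult.assoc by linarith+
  have "x1 * (1 - y1) \<le> 1 * 1" "(real k - 1) * (x2 * (1 - y2)) \<le> (real k - 1) * (1 * 1)"
    using x y k by (intro mult_mono mult_nonneg_nonneg; simp)+
  moreover have "0 \<le> x1 * (1 - y1)" "0 \<le> (real k - 1) * (x2 * (1 - y2))"
    using x y k by (auto intro!: mult_nonneg_nonneg)
  ultimately have d: "0 \<le> ?c" "?c \<le> real k" unfolding mult_1_right by linarith+
  have "0 \<le> ?X + ?Y" "?X + ?Y \<le> 2" using X Y by linarith+
  then have "0 \<le> (?X + ?Y)\<^sup>2" "(?X + ?Y)\<^sup>2 \<le> 2\<^sup>2" by (simp, intro power_mono)
  then have l: "0 \<le> \<rho> * (4 - (?X + ?Y)\<^sup>2)" "\<rho> * (4 - (?X + ?Y)\<^sup>2) \<le> \<rho> * 4"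
    using assms by (auto intro!: mult_left_mono)
  show "0 \<le> hidden_cut k m \<rho> w A1 A2 B1 B2 S"
    unfolding eq using q by (intro add_nonneg_nonneg[OF add_nonneg_nonneg[OF
      mult_nonneg_nonneg[OF _ g(1)] mult_nonneg_nonneg[OF q(1) d(1)]] l(1)]) auto
  have "(1 - q) * (real k * ?X * (1 - ?Y)) + q * ?c \<le> (1 - q) * real k + q * real k"
    using q by (intro add_mono mult_left_mono g(2) d(2)) auto
  with l show "hidden_cut k m \<rho> w A1 A2 B1 B2 S \<le> real k + 4 * \<rho>"
    unfolding eq by (simp add: algebra_simps)
qed

lemma fill_ratio_insert:
  assumes "finite P" "e \<notin> S"
  shows "fill_ratio k m P (insert e S) = fill_ratio k m P S + of_bool (e \<in> P) * (1 / (real k * real m))"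
  using assms by (auto simp: fill_ratio_def Int_insert_left add_divide_distrib)

lemma imbalance_insert:
  assumes "finite P" "finite Q" "P \<inter> Q = {}" "e \<notin> S"
  shows "imbalance k m P Q (insert e S) = imbalance k m P Q S +
     of_bool (e \<in> P \<union> Q) * (if e \<in> P then 1 / real m else - 1 / ((real k - 1) * real m))"
  using assms by (auto simp: imbalance_def Int_insert_left add_divide_distrib diff_divide_distrib)

text \<open>One element moves an imbalance by up to \<open>1 / m\<close> but a fill ratio only by
  \<open>1 / (k m)\<close>. The correction must therefore outweigh the error \<open>\<kappa>\<close>
  by a factor of order \<open>k^2\<close>.\<close>

lemma nonneg_submodular_hidden_cut:
  assumes w: "flat_weight \<kappa> \<gamma> w" and \<rho>: "\<kappa> * (real k)\<^sup>2 \<le> \<rho>" and "\<kappa> \<ge> 0"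
  shows "nonneg_submodular V (hidden_cut k m \<rho> w A1 A2 B1 B2)"
proof -
  let ?f = "hidden_cut k m \<rho> w A1 A2 B1 B2"
  have "0 \<le> \<kappa> * (real k)\<^sup>2" using assms by simp
  with \<rho> have "\<rho> \<ge> 0" by linarith
  have "?f (insert e (insert d S)) + ?f S \<le> ?f (insert e S) + ?f (insert d S)"
    if "e \<notin> S" "d \<notin> S" "e \<noteq> d" for S e d
  proof -
    define X where "X = fill_ratio k m (A1 \<union> A2) S"
    define Y where "Y = fill_ratio k m (B1 \<union> B2) S"
    define u where "u = imbalance k m A1 A2 S"
    define v where "v = imbalance k m B1 B2 S"
    define h where "h = 1 / (real k * real m)"
    define sA where "sA = (\<lambda>e. if e \<in> A1 then 1 / real m else - 1 / ((real k - 1) * real m))"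
    define sB where "sB = (\<lambda>e. if e \<in> B1 then 1 / real m else - 1 / ((real k - 1) * real m))"
    define a where "a = (\<lambda>e. of_bool (e \<in> A1 \<union> A2) * sA e)"
    define b where "b = (\<lambda>e. of_bool (e \<in> B1 \<union> B2) * sB e)"
    define x where "x = (\<lambda>e. of_bool (e \<in> A1 \<union> A2) * h)"
    define y where "y = (\<lambda>e. of_bool (e \<in> B1 \<union> B2) * h)"
    have shift: "fill_ratio k m (A1 \<union> A2) (insert e S) = fill_ratio k m (A1 \<union> A2) S + x e"
      "fill_ratio k m (B1 \<union> B2) (insert e S) = fill_ratio k m (B1 \<union> B2) S + y e"
      "imbalance k m A1 A2 (insert e S) = imbalance k m A1 A2 S + a e"
      "imbalance k m B1 B2 (insert e S) = imbalance k m B1 B2 S + b e" if "e \<notin> S" for e S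
      using that disj by (simp_all add: fill_ratio_insert imbalance_insert a_def b_def x_def y_def h_def sA_def sB_def)
    have range: "u \<in> {-1..1}" "u + a e \<in> {-1..1}" "u + a d \<in> {-1..1}" "u + a d + a e \<in> {-1..1}"
        "v \<in> {-1..1}" "v + b e \<in> {-1..1}" "v + b d \<in> {-1..1}" "v + b d + b e \<in> {-1..1}"
      using imbalance_range[of S] imbalance_range[of "insert e S"] imbalance_range[of "insert d S"]
        imbalance_range[of "insert e (insert d S)"] that
      by (auto simp: shift u_def v_def simp del: atLeastAtMost_iff)
    have goal: "cut_value k \<rho> w (X + x d + x e) (Y + y d + y e) (u + a d + a e) (v + b d + b e) + cut_value k \<rho> w X Y u v
       \<le> cut_value k \<rho> w (X + x e) (Y + y e) (u + a e) (v + b e) + cut_value k \<rho> w (X + x d) (Y + y d) (u + a d) (v + b d)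
       \<Longrightarrow> ?thesis"
      using that by (simp add: hidden_cut_def shift X_def Y_def u_def v_def)
    have h: "h > 0" "h * h = 1 / ((real k)\<^sup>2 * (real m)\<^sup>2)"
      using k m by (auto simp: h_def power2_eq_square)
    have k1: "real k - 1 \<ge> 1" using k by simp
    have sAB: "\<bar>sA e\<bar> \<le> 1 / m" "\<bar>sB e\<bar> \<le> 1 / m" for e
      using k1 m by (auto simp: sA_def sB_def divide_simps)
    have pure: "\<bar>s * r\<bar> * \<kappa> \<le> 2 * \<rho> * (h * h)" if "\<bar>s\<bar> \<le> 1 / m" "\<bar>r\<bar> \<le> 1 / m" for s r
    proof -
      have "\<bar>s * r\<bar> * \<kappa> \<le> (1 / m * (1 / m)) * \<kappa>"
        unfolding abs_mult using that \<open>\<kappa> \<ge> 0\<close> by (intro mult_right_mono mult_mono) auto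
      also have "\<dots> = (\<kappa> * (real k)\<^sup>2) * (h * h)"
        using k m by (simp add: h power2_eq_square)
      also have "\<dots> \<le> 2 * \<rho> * (h * h)" using \<rho> \<open>\<rho> \<ge> 0\<close> h by (intro mult_right_mono) auto
      finally show ?thesis .
    qed
    \<comment> \<open>The extreme case pairs a small part with the large part of the other side.
      There \<open>(k - 1) * (s * r) = - 1 / m^2\<close>, and
      \<open>k * (h * h) = 1 / (k m^2)\<close> cancels the loss of the exact cut with nothing to
      spare, so the excess \<open>\<kappa>\<close> is charged to \<open>\<rho>\<close>.\<close>
    have mixed: "- ((real k - 1) / real k * (s * r) * (1 + \<kappa>)) \<le> (real k + 2 * \<rho>) * (h * h)"
      if "s \<in> {1 / m, - 1 / ((real k - 1) * m)}" "r \<in> {1 / m, - 1 / ((real k - 1) * m)}" for s r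
    proof -
      have "- ((real k - 1) * (s * r)) \<le> 1 / (real m)\<^sup>2"
      proof -
        have "0 \<le> s * r \<or> (real k - 1) * (s * r) = - 1 / (real m)\<^sup>2"
          using that k1 m by (auto simp: power2_eq_square)
        moreover have "0 \<le> (real k - 1) * (s * r)" if "0 \<le> s * r"
          using k1 by (intro mult_nonneg_nonneg[OF _ that]) auto
        moreover have "0 \<le> 1 / (real m)\<^sup>2" by simp
        ultimately show ?thesis by linarith
      qed
      then have "- ((real k - 1) * (s * r)) * ((1 + \<kappa>) / real k) \<le> 1 / (real m)\<^sup>2 * ((1 + \<kappa>) / real k)"
        using \<open>\<kappa> \<ge> 0\<close> by (intro mult_right_mono) auto
      also have "\<dots> = (real k + \<kappa> * real k) * (h * h)"
        using k m by (simp add: h field_simps power2_eq_square)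
      also have "\<dots> \<le> (real k + 2 * \<rho>) * (h * h)"
      proof -
        have "\<kappa> * real k \<le> \<kappa> * (real k)\<^sup>2"
          using \<open>\<kappa> \<ge> 0\<close> k by (intro mult_left_mono) (auto simp: power2_eq_square)
        with \<rho> \<open>\<rho> \<ge> 0\<close> show ?thesis using h by (intro mult_right_mono) auto
      qed
      finally show ?thesis by (simp add: mult.assoc)
    qed
    have mixed0: "0 \<le> (real k + 2 * \<rho>) * (h * h)" using h \<open>\<rho> \<ge> 0\<close> by auto
    have sv: "sA e \<in> {1 / m, - 1 / ((real k - 1) * m)}" "sB e \<in> {1 / m, - 1 / ((real k - 1) * m)}" for e
      by (auto simp: sA_def sB_def)
    have inA: "a e = sA e" "b e = 0" "x e = h" "y e = 0" if "e \<in> A1 \<union> A2" for e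
      using that disj by (auto simp: a_def b_def x_def y_def)
    have inB: "a e = 0" "b e = sB e" "x e = 0" "y e = h" if "e \<in> B1 \<union> B2" for e
      using that disj by (auto simp: a_def b_def x_def y_def)
    have inN: "a e = 0" "b e = 0" "x e = 0" "y e = 0" if "e \<notin> A1 \<union> A2" "e \<notin> B1 \<union> B2" for e
      using that by (auto simp: a_def b_def x_def y_def)
    consider "e \<in> A1 \<union> A2" "d \<in> A1 \<union> A2" | "e \<in> B1 \<union> B2" "d \<in> B1 \<union> B2"
      | "e \<in> A1 \<union> A2" "d \<in> B1 \<union> B2" | "e \<in> B1 \<union> B2" "d \<in> A1 \<union> A2"
      | "e \<notin> A1 \<union> A2" "e \<notin> B1 \<union> B2" | "d \<notin> A1 \<union> A2" "d \<notin> B1 \<union> B2" by blast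
    then show ?thesis
    proof cases
      case 1
      with cut_value_pure(1)[OF w, of u "a d" "a e" v "real k" \<rho> "x d" "x e" X Y] range k1
        pure[OF sAB(1) sAB(1)]
      show ?thesis by (intro goal) (simp add: inA add.commute)
    next
      case 2
      with cut_value_pure(2)[OF w, of v "b d" "b e" u "real k" \<rho> "y d" "y e" X Y] range k1
        pure[OF sAB(2) sAB(2)]
      show ?thesis by (intro goal) (simp add: inB add.commute)
    next
      case 3
      with cut_value_mixed[OF w, of u "a e" v "b d" "real k" \<rho> "x e" "y d" X Y] range k1
        mixed[OF sv(1) sv(2)] mixed0
      show ?thesis by (intro goal) (simp add: inA inB)
    next
      case 4
      with cut_value_mixed[OF w, of u "a d" v "b e" "real k" \<rho> "x d" "y e" X Y] range k1
        mixed[OF sv(1) sv(2)] mixed0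
      show ?thesis by (intro goal) (simp add: inA inB)
    next
      case 5
      then show ?thesis by (intro goal) (simp add: inN)
    next
      case 6
      then show ?thesis by (intro goal) (simp add: inN)
    qed
  qed
  then show ?thesis
    unfolding nonneg_submodular_def using hidden_cut_bounds(1)[OF w \<open>\<rho> \<ge> 0\<close>] fin
    by (auto intro!: submodular_if_local[of V])
qed

text \<open>The imbalances are 1 and -1, where the weight is 1, so the full cut value 1 counts; the
  fill ratios add up to 1 and the correction adds \<open>3 * \<rho>\<close>.\<close>

lemma hidden_cut_optimum:
  assumes "w 1 (-1) = 1" "\<rho> \<ge> 0"
  shows "hidden_cut k m \<rho> w A1 A2 B1 B2 (A1 \<union> B2) \<ge> 1"
proof -
  have e: "(A1 \<union> B2) \<inter> (A1 \<union> A2) = A1" "(A1 \<union> B2) \<inter> (B1 \<union> B2) = B2" "(A1 \<union> B2) \<inter> A1 = A1"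
    "(A1 \<union> B2) \<inter> A2 = {}" "(A1 \<union> B2) \<inter> B1 = {}" "(A1 \<union> B2) \<inter> B2 = B2"
    using disj by auto
  have X: "fill_ratio k m (A1 \<union> A2) (A1 \<union> B2) = 1 / k" "fill_ratio k m (B1 \<union> B2) (A1 \<union> B2) = (real k - 1) / k"
    "imbalance k m A1 A2 (A1 \<union> B2) = 1" "imbalance k m B1 B2 (A1 \<union> B2) = - 1"
    using k m by (auto simp: fill_ratio_def imbalance_def e card real_k)
  have "1 / real k + (real k - 1) / real k = 1" using k by (simp add: field_simps)
  then have "hidden_cut k m \<rho> w A1 A2 B1 B2 (A1 \<union> B2) = 1 + 3 * \<rho>"
    using k assms by (simp add: hidden_cut_def cut_value_def X)
  with assms show ?thesis by simp
qed

lemma hidden_cut_balanced: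
  assumes "flat_weight \<kappa> \<gamma> w" "(imbalance k m A1 A2 S)\<^sup>2 + (imbalance k m B1 B2 S)\<^sup>2 \<le> \<gamma>"
  shows "hidden_cut k m \<rho> w A1 A2 B1 B2 S = hidden_cut k m \<rho> (\<lambda>_ _. 0) A1 A2 B1 B2 S"
  using assms by (auto simp: hidden_cut_def cut_value_def flat_weight_def)

end

section \<open>Random hidden partitions\<close>

definition shifts :: "nat \<Rightarrow> nat \<Rightarrow> (nat \<Rightarrow> nat) pmf" where
  "shifts k m = Pi_pmf {..<m} 0 (\<lambda>_. pmf_of_set {..<k})"

text \<open>Picking one element \<open>j * k + s j\<close> independently from each block of \<open>k\<close> consecutive elements
  gives hidden parts of exactly the right size, and still sums of independent variables.\<close>
definition transversal :: "nat \<Rightarrow> nat \<Rightarrow> (nat \<Rightarrow> nat) \<Rightarrow> nat set" where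
  "transversal k m s = (\<lambda>j. j * k + s j) ` {..<m}"

lemma shifts_less:
  assumes "k \<ge> 1" "s \<in> set_pmf (shifts k m)" "j < m"
  shows "s j < k"
proof -
  have "{..<k} \<noteq> {}" using assms by (auto simp: lessThan_empty_iff)
  then show ?thesis
    using assms unfolding shifts_def by (subst (asm) set_Pi_pmf) (auto simp: PiE_dflt_def)
qed

lemma finite_set_shifts:
  assumes "k \<ge> 1"
  shows "finite (set_pmf (shifts k m))"
proof -
  have "{..<k} \<noteq> {}" using assms by (auto simp: lessThan_empty_iff)
  then show ?thesis
    unfolding shifts_def by (subst set_Pi_pmf) (auto intro!: finite_PiE_dflt)
qed

lemma inj_on_transversal:
  fixes k :: nat
  assumes "\<And>j. j < m \<Longrightarrow> s j < k"
  shows "inj_on (\<lambda>j. j * k + s j) {..<m}"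
proof (rule inj_onI)
  have "(j * k + s j) div k = j" if "j < m" for j using assms[OF that] by simp
  then show "i = j" if "i \<in> {..<m}" "j \<in> {..<m}" "i * k + s i = j * k + s j" for i j
    using that by (metis lessThan_iff)
qed

lemma transversal_subset:
  assumes "\<And>j. j < m \<Longrightarrow> s j < k"
  shows "transversal k m s \<subseteq> {..<k * m}"
proof
  fix x assume "x \<in> transversal k m s"
  then obtain j where j: "j < m" "x = j * k + s j" by (auto simp: transversal_def)
  then have "x < Suc j * k" using assms[of j] by simp
  also have "\<dots> \<le> m * k" using j by (intro mult_le_mono1) simp
  finally show "x \<in> {..<k * m}" by (simp add: mult.commute)
qed

lemma card_transversal:
  assumes "\<And>j. j < m \<Longrightarrow> s j < k"
  shows "card (transversal k m s) = m"
  unfolding transversal_def using inj_on_transversal[OF assms] by (subst card_image) auto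

lemma card_Int_transversal:
  assumes "\<And>j. j < m \<Longrightarrow> s j < k"
  shows "real (card (S \<inter> transversal k m s)) = (\<Sum>j<m. indicator S (j * k + s j))"
proof -
  have "real (card (S \<inter> transversal k m s)) = (\<Sum>i\<in>transversal k m s. indicator S i)"
    by (simp add: transversal_def indicator_def sum.If_cases Int_commute)
  also have "\<dots> = (\<Sum>j<m. indicator S (j * k + s j))"
    unfolding transversal_def using inj_on_transversal[OF assms] by (subst sum.reindex) auto
  finally show ?thesis .
qed

text \<open>The intersection size is a sum of \<open>m\<close> independent indicators, one per
  block, to which Hoeffding applies. The blocks tile \<open>{..<k * m}\<close>, so the block
  averages add up to \<open>1 / k\<close> of the intersection with the whole side.\<close>

lemma transversal_concentration:
  assumes k: "k \<ge> 1" and m: "m \<ge> 1" and e: "e \<ge> 0"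
  shows "measure_pmf.prob (shifts k m)
      {s. \<bar>real (card (S \<inter> transversal k m s)) - real (card (S \<inter> {..<k * m})) / real k\<bar> \<ge> e}
    \<le> 2 * exp (- 2 * e\<^sup>2 / real m)"
proof -
  let ?M = "measure_pmf (shifts k m)"
  define X where "X = (\<lambda>j (s :: nat \<Rightarrow> nat). indicator S (j * k + s j) :: real)"
  have ne: "{..<k} \<noteq> {}" using k by (auto simp: lessThan_empty_iff)
  interpret Hoeffding_ineq ?M "{..<m}" X "\<lambda>_. 0" "\<lambda>_. 1" "\<Sum>j<m. measure_pmf.expectation (shifts k m) (X j)"
  proof unfold_locales
    have "prob_space.indep_vars (measure_pmf (shifts k m)) (\<lambda>_. count_space UNIV) (\<lambda>j s. s j) {..<m}"
      unfolding shifts_def by (intro indep_vars_Pi_pmf) auto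
    then show "prob_space.indep_vars (measure_pmf (shifts k m)) (\<lambda>_. borel) X {..<m}"
      unfolding X_def by (rule prob_space.indep_vars_compose2[OF measure_pmf.prob_space_axioms]) auto
  qed (auto simp: X_def)
  have EX: "measure_pmf.expectation (shifts k m) (X j) = (\<Sum>i=j * k..<j * k + k. indicator S i) / real k"
    if "j < m" for j
  proof -
    have "measure_pmf.expectation (shifts k m) (X j)
        = measure_pmf.expectation (map_pmf (\<lambda>s. s j) (shifts k m)) (\<lambda>p. indicator S (j * k + p))"
      by (simp add: X_def)
    also have "map_pmf (\<lambda>s. s j) (shifts k m) = pmf_of_set {..<k}"
      unfolding shifts_def using that by (subst Pi_pmf_component) auto
    also have "measure_pmf.expectation (pmf_of_set {..<k}) (\<lambda>p. indicator S (j * k + p) :: real)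
        = (\<Sum>p<k. indicator S (j * k + p)) / real k"
      using ne by (subst integral_pmf_of_set) auto
    also have "(\<Sum>p<k. indicator S (j * k + p) :: real) = (\<Sum>i=j * k..<j * k + k. indicator S i)"
      by (rule sum.reindex_bij_witness[of _ "\<lambda>i. i - j * k" "\<lambda>p. j * k + p"]) auto
    finally show ?thesis .
  qed
  have "(\<Sum>j<m. measure_pmf.expectation (shifts k m) (X j))
      = (\<Sum>j<m. \<Sum>i=j * k..<j * k + k. indicator S i) / real k"
    by (simp add: EX sum_divide_distrib)
  also have "(\<Sum>j<m. \<Sum>i=j * k..<j * k + k. indicator S i :: real) = real (card (S \<inter> {..<k * m}))"
    by (subst sum.nat_group) (simp add: indicator_def sum.If_cases mult.commute Int_commute)
  finally have mu: "(\<Sum>j<m. measure_pmf.expectation (shifts k m) (X j)) = real (card (S \<inter> {..<k * m})) / real k" .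
  have "measure_pmf.prob (shifts k m)
      {s. \<bar>real (card (S \<inter> transversal k m s)) - real (card (S \<inter> {..<k * m})) / real k\<bar> \<ge> e}
     = measure_pmf.prob (shifts k m) {s \<in> space ?M. \<bar>(\<Sum>j<m. X j s) - real (card (S \<inter> {..<k * m})) / real k\<bar> \<ge> e}"
    by (rule measure_pmf.finite_measure_eq_AE)
       (auto simp: AE_measure_pmf_iff card_Int_transversal shifts_less[OF k] X_def)
  also have "\<dots> \<le> 2 * exp (- 2 * e\<^sup>2 / (\<Sum>j<m. (1 - 0)\<^sup>2))"
    using Hoeffding_ineq_abs_ge[OF e] m unfolding mu by simp
  finally show ?thesis by simp
qed

text \<open>With \<open>c1\<close> elements of \<open>S\<close> in the transversal and
  \<open>c\<close> in the side, the imbalance is \<open>k / (k - 1) * (c1 - c / k) / m\<close>. As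
  \<open>k / (k - 1) \<le> 2\<close>, an imbalance of \<open>sqrt g\<close> forces a deviation of
  \<open>m * sqrt g / 2\<close>.\<close>

lemma imbalance_transversal_prob:
  assumes k: "k \<ge> 2" and m: "m \<ge> 1" and "g \<ge> 0"
  shows "measure_pmf.prob (shifts k m)
      {s. (imbalance k m (transversal k m s) ({..<k * m} - transversal k m s) S)\<^sup>2 \<ge> g}
    \<le> 2 * exp (- (g * real m / 2))"
proof -
  have "measure_pmf.prob (shifts k m)
      {s. (imbalance k m (transversal k m s) ({..<k * m} - transversal k m s) S)\<^sup>2 \<ge> g}
    \<le> measure_pmf.prob (shifts k m)
      {s. \<bar>real (card (S \<inter> transversal k m s)) - real (card (S \<inter> {..<k * m})) / real k\<bar> \<ge> m * sqrt g / 2}"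
  proof (rule measure_pmf.finite_measure_mono_AE)
    show "AE s in measure_pmf (shifts k m).
       s \<in> {s. (imbalance k m (transversal k m s) ({..<k * m} - transversal k m s) S)\<^sup>2 \<ge> g} \<longrightarrow>
       s \<in> {s. \<bar>real (card (S \<inter> transversal k m s)) - real (card (S \<inter> {..<k * m})) / real k\<bar> \<ge> m * sqrt g / 2}"
      unfolding AE_measure_pmf_iff mem_Collect_eq
    proof (intro ballI impI)
      fix s assume s: "s \<in> set_pmf (shifts k m)"
        and big: "g \<le> (imbalance k m (transversal k m s) ({..<k * m} - transversal k m s) S)\<^sup>2"
      define T where "T = transversal k m s"
      have T: "T \<subseteq> {..<k * m}"
        unfolding T_def using shifts_less[of k s m] s k by (intro transversal_subset) auto
      define c where "c = real (card (S \<inter> {..<k * m}))"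
      define c1 where "c1 = real (card (S \<inter> T))"
      have "S \<inter> ({..<k * m} - T) = S \<inter> {..<k * m} - S \<inter> T" by auto
      moreover have "card (S \<inter> {..<k * m} - S \<inter> T) = card (S \<inter> {..<k * m}) - card (S \<inter> T)"
        using T by (intro card_Diff_subset) (auto intro: finite_subset)
      moreover have "card (S \<inter> T) \<le> card (S \<inter> {..<k * m})" using T by (intro card_mono) auto
      ultimately have "real (card (S \<inter> ({..<k * m} - T))) = c - c1"
        by (simp add: c_def c1_def of_nat_diff)
      then have "imbalance k m T ({..<k * m} - T) S = c1 / m - (c - c1) / ((real k - 1) * m)"
        by (simp add: imbalance_def c1_def)
      also have "\<dots> = real k / (real k - 1) * ((c1 - c / k) / m)"
      proof -
        have "c1 / M - (c - c1) / (K * M) = (K + 1) / K * ((c1 - c / (K + 1)) / M)"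
          if "K > 0" "M > 0" for K M :: real
          using that by (simp add: divide_simps) (simp add: algebra_simps)
        moreover have "real k - 1 > 0" "real m > 0" using k m by auto
        ultimately show ?thesis by (metis diff_add_cancel)
      qed
      finally have i: "imbalance k m T ({..<k * m} - T) S = real k / (real k - 1) * ((c1 - c / k) / m)" .
      have "sqrt g \<le> \<bar>imbalance k m T ({..<k * m} - T) S\<bar>"
        using big real_sqrt_le_mono[OF big] by (simp add: T_def)
      also have "\<dots> = real k / (real k - 1) * (\<bar>c1 - c / k\<bar> / m)"
        unfolding i abs_mult using k by simp
      also have "\<dots> \<le> 2 * (\<bar>c1 - c / k\<bar> / m)"
      proof (rule mult_right_mono)
        show "real k / (real k - 1) \<le> 2" using k by (simp add: divide_simps)
      qed simp
      finally have "sqrt g * m \<le> 2 * \<bar>c1 - c / k\<bar>" using m by (simp add: field_simps)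
      then show "m * sqrt g / 2 \<le> \<bar>real (card (S \<inter> transversal k m s)) - real (card (S \<inter> {..<k * m})) / real k\<bar>"
        by (simp add: c_def c1_def T_def mult.commute)
    qed
  qed simp
  also have "\<dots> \<le> 2 * exp (- 2 * (m * sqrt g / 2)\<^sup>2 / m)"
    using assms by (intro transversal_concentration) auto
  also have "- 2 * (m * sqrt g / 2)\<^sup>2 / m = - (g * real m / 2)"
    using assms by (simp add: power2_eq_square field_simps)
  finally show ?thesis .
qed

lemma imbalance_image_add:
  "imbalance k m ((+) c ` P) ((+) c ` Q) S = imbalance k m P Q {i. c + i \<in> S}"
proof -
  have "card (S \<inter> (+) c ` P) = card ({i. c + i \<in> S} \<inter> P)" for P
  proof -
    have "S \<inter> (+) c ` P = (+) c ` ({i. c + i \<in> S} \<inter> P)" by auto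
    then show ?thesis by (simp add: card_image)
  qed
  then show ?thesis by (simp add: imbalance_def)
qed

text \<open>Both sides use the same random \<open>s\<close>, the second one in a translated copy. A
  union bound, with \<open>g / 2\<close> for each side, makes their dependence harmless.\<close>

lemma unbalanced_prob:
  assumes k: "k \<ge> 2" and m: "m \<ge> 1" and "g \<ge> 0"
  defines "T \<equiv> transversal k m"
  shows "measure_pmf.prob (shifts k m)
      {s. \<not> (imbalance k m (T s) ({..<k * m} - T s) S)\<^sup>2 +
            (imbalance k m ((+) (k * m) ` T s) ((+) (k * m) ` ({..<k * m} - T s)) S)\<^sup>2 \<le> g}
    \<le> 4 * exp (- (g * real m / 4))" (is "?p {s. \<not> (?a S s)\<^sup>2 + (?b s)\<^sup>2 \<le> g} \<le> _")
proof -
  let ?S = "{i. k * m + i \<in> S}"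
  have "?p {s. \<not> (?a S s)\<^sup>2 + (?b s)\<^sup>2 \<le> g} \<le> ?p ({s. (?a S s)\<^sup>2 \<ge> g / 2} \<union> {s. (?a ?S s)\<^sup>2 \<ge> g / 2})"
    by (intro measure_pmf.finite_measure_mono) (auto simp: imbalance_image_add)
  also have "\<dots> \<le> ?p {s. (?a S s)\<^sup>2 \<ge> g / 2} + ?p {s. (?a ?S s)\<^sup>2 \<ge> g / 2}"
    by (intro measure_Un_le) auto
  also have "\<dots> \<le> 2 * exp (- (g / 2 * real m / 2)) + 2 * exp (- (g / 2 * real m / 2))"
    unfolding T_def using assms by (intro add_mono imbalance_transversal_prob) auto
  finally show ?thesis by simp
qed

lemma hidden_partition_transversal:
  assumes k: "k \<ge> 2" and m: "m \<ge> 1" and V: "finite V" "{..<2 * (k * m)} \<subseteq> V"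
    and s: "s \<in> set_pmf (shifts k m)"
  defines "T \<equiv> transversal k m s"
  shows "hidden_partition V T ({..<k * m} - T) ((+) (k * m) ` T) ((+) (k * m) ` ({..<k * m} - T)) k m"
proof -
  have T: "T \<subseteq> {..<k * m}" "card T = m"
    unfolding T_def using shifts_less[of k s m] s k by (auto intro!: transversal_subset card_transversal)
  then have "card ({..<k * m} - T) = (k - 1) * m"
    by (subst card_Diff_subset) (auto intro: finite_subset simp: diff_mult_distrib)
  then show ?thesis
    using assms T by unfold_locales (auto simp: card_image subset_iff)
qed

section \<open>Multilinear extension and averaging over instances\<close>

text \<open>For \<open>x\<close> in the unit cube, the probability of obtaining \<open>S\<close>
  when each \<open>i\<close> is included independently with probability \<open>x i\<close>.\<close>

definition rounding :: "nat set \<Rightarrow> (nat \<Rightarrow> real) \<Rightarrow> nat set \<Rightarrow> real" where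
  "rounding V x S = (\<Prod>i\<in>S. x i) * (\<Prod>j\<in>V - S. 1 - x j)"

lemma multilinear_rounding: "multilinear V f x = (\<Sum>S\<in>Pow V. f S * rounding V x S)"
  by (simp add: multilinear_def rounding_def mult.assoc)

lemma rounding_nonneg:
  assumes "\<And>i. i \<in> V \<Longrightarrow> x i \<in> {0..1}" "S \<subseteq> V"
  shows "0 \<le> rounding V x S"
  using assms unfolding rounding_def by (intro mult_nonneg_nonneg prod_nonneg) auto

lemma sum_rounding:
  assumes "finite V"
  shows "(\<Sum>S\<in>Pow V. rounding V x S) = 1"
  using prod_add[OF assms, of x "\<lambda>i. 1 - x i"] by (simp add: rounding_def)

lemma multilinear_mono:
  assumes "\<And>i. i \<in> V \<Longrightarrow> x i \<in> {0..1}" "\<And>S. S \<subseteq> V \<Longrightarrow> f S \<le> g S"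
  shows "multilinear V f x \<le> multilinear V g x"
  unfolding multilinear_rounding using assms
  by (intro sum_mono mult_right_mono rounding_nonneg) auto

lemma multilinear_const:
  assumes "finite V"
  shows "multilinear V (\<lambda>_. c) x = c"
  using sum_rounding[OF assms, of x] by (simp add: multilinear_rounding flip: sum_distrib_left)

lemma multilinear_add: "multilinear V (\<lambda>S. f S + g S) x = multilinear V f x + multilinear V g x"
  by (simp add: multilinear_rounding distrib_right sum.distrib)

lemma multilinear_cmult: "multilinear V (\<lambda>S. c * f S) x = c * multilinear V f x"
  by (simp add: multilinear_rounding sum_distrib_left mult.assoc)

lemma multilinear_sum: "multilinear V (\<lambda>S. \<Sum>i\<in>I. f i S) x = (\<Sum>i\<in>I. multilinear V (f i) x)"
  unfolding multilinear_rounding sum_distrib_right by (rule sum.swap)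

text \<open>The indicator is absorbed into the product: setting the factor for \<open>b\<close> in
  \<open>S\<close> and the factor for \<open>a\<close> outside \<open>S\<close> to zero kills
  exactly the unwanted sets, after which the sum over all sets factorizes.\<close>

lemma multilinear_arc:
  assumes "finite V" "a \<in> V" "b \<in> V" "a \<noteq> b"
  shows "multilinear V (\<lambda>S. of_bool (a \<in> S) * of_bool (b \<notin> S)) x = x a * (1 - x b)"
proof -
  define p where "p = (\<lambda>i. if i = b then 0 else x i)"
  define q where "q = (\<lambda>i. if i = a then 0 else 1 - x i)"
  have "multilinear V (\<lambda>S. of_bool (a \<in> S) * of_bool (b \<notin> S)) x = (\<Sum>S\<in>Pow V. prod p S * prod q (V - S))"
    unfolding multilinear_rounding
  proof (rule sum.cong)
    fix S assume "S \<in> Pow V"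
    then have fin: "finite S" "finite (V - S)" using assms(1) by (auto intro: finite_subset)
    show "of_bool (a \<in> S) * of_bool (b \<notin> S) * rounding V x S = prod p S * prod q (V - S)"
    proof (cases "a \<in> S \<and> b \<notin> S")
      case True
      then have "prod p S = prod x S" "prod q (V - S) = (\<Prod>j\<in>V - S. 1 - x j)"
        unfolding p_def q_def by (auto intro!: prod.cong)
      with True show ?thesis by (simp add: rounding_def)
    next
      case False
      then have "prod p S = 0 \<or> prod q (V - S) = 0"
        using assms fin by (auto simp: p_def q_def prod_zero_iff)
      with False show ?thesis by auto
    qed
  qed simp
  also have "\<dots> = (\<Prod>i\<in>V. p i + q i)" by (rule prod_add[OF assms(1), symmetric])
  also have "\<dots> = (\<Prod>i\<in>V. if i = a then x a else if i = b then 1 - x b else 1)"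
    using assms by (intro prod.cong) (auto simp: p_def q_def)
  also have "\<dots> = x a * (\<Prod>i\<in>V - {a}. if i = b then 1 - x b else 1)"
    using assms by (subst prod.remove[of V a]) (auto intro!: prod.cong)
  also have "(\<Prod>i\<in>V - {a}. if i = b then 1 - x b else 1) = 1 - x b"
    using assms by (subst prod.delta) auto
  finally show ?thesis .
qed

text \<open>Independent rounding of an integral point is deterministic. This lets a set output be
  treated as a fractional one, so that one argument serves both problems.\<close>

lemma multilinear_indic:
  assumes "finite V" "T \<subseteq> V"
  shows "multilinear V f (indic_vec T) = f T"
proof -
  have r: "rounding V (indic_vec T) S = of_bool (S = T)" if "S \<subseteq> V" for S
  proof -
    have fin: "finite S" "finite (V - S)" using assms that by (auto intro: finite_subset)
    show ?thesis
    proof (cases "S = T")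
      case True
      then show ?thesis by (auto simp: rounding_def indic_vec_def intro!: prod.neutral)
    next
      case False
      then have "(\<exists>i\<in>S. i \<notin> T) \<or> (\<exists>i\<in>V - S. i \<in> T)" using that assms by auto
      with False fin show ?thesis by (auto simp: rounding_def indic_vec_def)
    qed
  qed
  have "multilinear V f (indic_vec T) = (\<Sum>S\<in>Pow V. if S = T then f S else 0)"
    unfolding multilinear_rounding by (intro sum.cong) (auto simp: r)
  then show ?thesis using assms by simp
qed

section \<open>Points of the polytope and linear bounds on them\<close>

lemma indic_vec_in_polytope:
  assumes "finite Fs" "S \<in> Fs"
  shows "indic_vec S \<in> polytope Fs"
proof -
  have "(\<lambda>i. \<Sum>T\<in>Fs. of_bool (T = S) * indic_vec T i) = indic_vec S"
  proof
    fix i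
    have "(\<Sum>T\<in>Fs. of_bool (T = S) * indic_vec T i) = (\<Sum>T\<in>Fs. if T = S then indic_vec T i else 0)"
      by (intro sum.cong) auto
    then show "(\<Sum>T\<in>Fs. of_bool (T = S) * indic_vec T i) = indic_vec S i" using assms by simp
  qed
  moreover have "(\<Sum>T\<in>Fs. of_bool (T = S)) = (1 :: real)"
    using assms by (simp add: of_bool_def)
  ultimately show ?thesis unfolding polytope_def
    by (auto intro!: exI[of _ "\<lambda>T. of_bool (T = S)"])
qed

text \<open>The sets \<open>S p\<close> may coincide, whereas \<open>polytope\<close> allots one
  weight to each set; the weights are therefore collected over the fibres of
  \<open>S\<close>.\<close>

lemma mixture_in_polytope:
  assumes "finite Fs" "finite P" "\<And>p. p \<in> P \<Longrightarrow> S p \<in> Fs" "\<And>p. p \<in> P \<Longrightarrow> 0 \<le> c p" "(\<Sum>p\<in>P. c p) = 1"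
  shows "(\<lambda>i. \<Sum>p\<in>P. c p * indic_vec (S p) i) \<in> polytope Fs"
proof -
  define w where "w = (\<lambda>T. \<Sum>p\<in>{p\<in>P. S p = T}. c p)"
  have "(\<Sum>T\<in>Fs. w T) = 1"
    unfolding w_def using assms by (subst sum.group) auto
  moreover have "(\<lambda>i. \<Sum>p\<in>P. c p * indic_vec (S p) i) = (\<lambda>i. \<Sum>T\<in>Fs. w T * indic_vec T i)"
  proof
    fix i
    have "(\<Sum>p\<in>P. c p * indic_vec (S p) i) = (\<Sum>T\<in>Fs. \<Sum>p\<in>{p\<in>P. S p = T}. c p * indic_vec (S p) i)"
      using assms by (subst sum.group) auto
    also have "\<dots> = (\<Sum>T\<in>Fs. w T * indic_vec T i)"
      unfolding w_def sum_distrib_right by (intro sum.cong) auto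
    finally show "(\<Sum>p\<in>P. c p * indic_vec (S p) i) = (\<Sum>T\<in>Fs. w T * indic_vec T i)" .
  qed
  moreover have "\<forall>T\<in>Fs. 0 \<le> w T" unfolding w_def using assms(4) by (auto intro!: sum_nonneg)
  ultimately show ?thesis unfolding polytope_def by blast
qed

lemma polytope_range:
  assumes "x \<in> polytope Fs"
  shows "x i \<in> {0..1}"
proof -
  from assms obtain w where w: "\<forall>S\<in>Fs. 0 \<le> w S" "(\<Sum>S\<in>Fs. w S) = 1"
    "x = (\<lambda>i. \<Sum>S\<in>Fs. w S * indic_vec S i)" by (auto simp: polytope_def)
  have "0 \<le> x i" using w(1) unfolding w(3) by (auto simp: indic_vec_def intro!: sum_nonneg)
  moreover have "x i \<le> (\<Sum>S\<in>Fs. w S)" using w(1) unfolding w(3)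
    by (auto simp: indic_vec_def intro!: sum_mono)
  ultimately show ?thesis using w(2) by simp
qed

lemma polytope_sum:
  assumes "x \<in> polytope Fs" "finite P" "\<And>S. S \<in> Fs \<Longrightarrow> real (card (S \<inter> P)) \<le> c"
  shows "(\<Sum>i\<in>P. x i) \<le> c"
proof -
  from assms obtain w where w: "\<forall>S\<in>Fs. 0 \<le> w S" "(\<Sum>S\<in>Fs. w S) = 1"
    "x = (\<lambda>i. \<Sum>S\<in>Fs. w S * indic_vec S i)" by (auto simp: polytope_def)
  have "(\<Sum>i\<in>P. x i) = (\<Sum>S\<in>Fs. w S * (\<Sum>i\<in>P. indic_vec S i))"
    unfolding w(3) sum_distrib_left by (rule sum.swap)
  also have "\<dots> = (\<Sum>S\<in>Fs. w S * real (card (S \<inter> P)))"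
    using assms(2) by (simp add: indic_vec_def sum.If_cases Int_commute)
  also have "\<dots> \<le> (\<Sum>S\<in>Fs. w S * c)"
    using w(1) assms(3) by (intro sum_mono mult_left_mono) auto
  also have "\<dots> = c" using w(2) by (simp flip: sum_distrib_right)
  finally show ?thesis .
qed

lemma polytope_sum_ge:
  assumes "x \<in> polytope Fs" "finite P" "\<And>S. S \<in> Fs \<Longrightarrow> c \<le> real (card (S \<inter> P))"
  shows "c \<le> (\<Sum>i\<in>P. x i)"
proof -
  from assms obtain w where w: "\<forall>S\<in>Fs. 0 \<le> w S" "(\<Sum>S\<in>Fs. w S) = 1"
    "x = (\<lambda>i. \<Sum>S\<in>Fs. w S * indic_vec S i)" by (auto simp: polytope_def)
  have "c = (\<Sum>S\<in>Fs. w S * c)" using w(2) by (simp flip: sum_distrib_right)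
  also have "\<dots> \<le> (\<Sum>S\<in>Fs. w S * real (card (S \<inter> P)))"
    using w(1) assms(3) by (intro sum_mono mult_left_mono) auto
  also have "\<dots> = (\<Sum>S\<in>Fs. w S * (\<Sum>i\<in>P. indic_vec S i))"
    using assms(2) by (simp add: indic_vec_def sum.If_cases Int_commute)
  also have "\<dots> = (\<Sum>i\<in>P. x i)"
    unfolding w(3) sum_distrib_left by (rule sum.swap)
  finally show ?thesis .
qed

section \<open>Indistinguishability and averaging over hidden partitions\<close>

text \<open>\<open>T\<close> collects the queries on the single path that \<open>A\<close> follows
  when answered by \<open>g\<close>; an oracle agreeing there never makes it leave that
  path.\<close>

lemma run_depends_on_few_queries:
  "\<exists>T. finite T \<and> card T \<le> q \<and> (\<forall>g'. (\<forall>Q\<in>T. g' Q = g Q) \<longrightarrow> run A g' q h = run A g q h)"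
proof (induction q arbitrary: h)
  case 0
  show ?case by (intro exI[of _ "{}"]) (auto split: step.split)
next
  case (Suc q)
  show ?case
  proof (cases "A h")
    case (Query Q)
    obtain T where T: "finite T" "card T \<le> q"
      "\<forall>g'. (\<forall>Q\<in>T. g' Q = g Q) \<longrightarrow> run A g' q (h @ [(Q, g Q)]) = run A g q (h @ [(Q, g Q)])"
      using Suc by blast
    show ?thesis
    proof (intro exI[of _ "insert Q T"] conjI allI impI)
      show "card (insert Q T) \<le> Suc q" using card_insert_le_m1[of "Suc q" T Q] T(2) by simp
      fix g' assume g': "\<forall>Q\<in>insert Q T. g' Q = g Q"
      with T(3) have "run A g' q (h @ [(Q, g Q)]) = run A g q (h @ [(Q, g Q)])" by blast
      with g' show "run A g' (Suc q) h = run A g (Suc q) h" by (simp add: Query)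
    qed (use T(1) in simp)
  qed (auto intro!: exI[of _ "{}"])
qed

text \<open>Yao's principle: the random instance \<open>f s\<close> is answered as the fixed instance \<open>f_sym\<close>
  until an unbalanced set is queried, so the algorithm must output nearly independently of \<open>s\<close>.\<close>
lemma hard_instance_exists:
  fixes f :: "'s \<Rightarrow> nat set \<Rightarrow> real" and R :: "'o algorithm pmf" and D :: "'s pmf"
  assumes V: "finite V" and D: "finite (set_pmf D)"
    and range: "\<And>s S. s \<in> set_pmf D \<Longrightarrow> S \<subseteq> V \<Longrightarrow> f s S \<in> {0..M}"
    and f_sym: "\<And>S. S \<subseteq> V \<Longrightarrow> 0 \<le> f_sym S"
    and balanced: "\<And>s S. s \<in> set_pmf D \<Longrightarrow> S \<subseteq> V \<Longrightarrow> bal s S \<Longrightarrow> f s S = f_sym S"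
    and rare: "\<And>S. S \<subseteq> V \<Longrightarrow> measure_pmf.prob D {s. \<not> bal s S} \<le> \<delta>"
    and P: "\<And>x i. x \<in> P \<Longrightarrow> x i \<in> {0..1}" "\<And>x. x \<in> P \<Longrightarrow> multilinear V f_sym x \<le> \<beta>"
    and out: "\<And>A s. A \<in> set_pmf R \<Longrightarrow> s \<in> set_pmf D \<Longrightarrow> val (the (run A (val_oracle V (f s)) q [])) \<in> P"
      "\<And>A. A \<in> set_pmf R \<Longrightarrow> val (the (run A (val_oracle V f_sym) q [])) \<in> P"
  shows "\<exists>s\<in>set_pmf D. measure_pmf.expectation R
           (\<lambda>A. multilinear V (f s) (val (the (run A (val_oracle V (f s)) q [])))) \<le> \<beta> + M * (1 + real q) * \<delta>"
proof (rule ccontr)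
  define y where "y = (\<lambda>s A. multilinear V (f s) (val (the (run A (val_oracle V (f s)) q []))))"
  let ?b = "\<beta> + M * (1 + real q) * \<delta>"
  assume "\<not> ?thesis"
  then have large: "measure_pmf.expectation R (y s) > ?b" if "s \<in> set_pmf D" for s
    using that by (force simp: y_def)
  have y: "y s A \<in> {0..M}" if "A \<in> set_pmf R" "s \<in> set_pmf D" for s A
  proof -
    note x = P(1)[OF out(1)[OF that]]
    have "multilinear V (\<lambda>_. 0) (val (the (run A (val_oracle V (f s)) q []))) \<le> y s A"
      "y s A \<le> multilinear V (\<lambda>_. M) (val (the (run A (val_oracle V (f s)) q [])))"
      unfolding y_def using range that x by (auto intro!: multilinear_mono)
    then show ?thesis by (simp add: multilinear_const V)
  qed
  obtain s0 where s0: "s0 \<in> set_pmf D" using set_pmf_not_empty[of D] by blast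
  have M: "M \<ge> 0" using range[OF s0, of "{}"] by simp
  have int: "integrable (measure_pmf R) (y s)" if "s \<in> set_pmf D" for s
    using y[OF _ that] by (intro measure_pmf.integrable_const_bound[where B = M])
      (auto simp: AE_measure_pmf_iff)
  have intD: "integrable (measure_pmf D) g" for g :: "'s \<Rightarrow> real"
    using D by (rule integrable_measure_pmf_finite)
  have per_algorithm: "measure_pmf.expectation D (\<lambda>s. y s A) \<le> ?b" if A: "A \<in> set_pmf R" for A
  proof -
    define x where "x = val (the (run A (val_oracle V f_sym) q []))"
    have x: "x \<in> P" unfolding x_def using out(2)[OF A] .
    have rn: "0 \<le> rounding V x S" if "S \<subseteq> V" for S
      using P(1)[OF x] that by (intro rounding_nonneg) auto
    obtain T where T: "finite T" "card T \<le> q"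
      "\<And>g'. (\<forall>Q\<in>T. g' Q = val_oracle V f_sym Q) \<Longrightarrow> run A g' q [] = run A (val_oracle V f_sym) q []"
      using run_depends_on_few_queries[of q "val_oracle V f_sym" A "[]"] by blast
    define bad where "bad = (\<lambda>S s. indicator {s. \<not> bal s S} s :: real)"
    have bad: "measure_pmf.expectation D (bad S) \<le> \<delta>" if "S \<subseteq> V" for S
      using rare[OF that] by (simp add: bad_def)
    have bad0: "0 \<le> bad S s" for S s by (simp add: bad_def)
    \<comment> \<open>Either some query is unbalanced and \<open>M\<close> bounds the value
      outright, or the output is the fixed point \<open>x\<close>, whose value can exceed that of
      \<open>f_sym\<close> only through unbalanced sets arising when \<open>x\<close> is
      rounded.\<close>
    have pointwise: "y s A \<le> \<beta> + M * ((\<Sum>S\<in>Pow V. rounding V x S * bad S s) + (\<Sum>Q\<in>T. bad (Q \<inter> V) s))"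
      if s: "s \<in> set_pmf D" for s
    proof (cases "\<forall>Q\<in>T. bal s (Q \<inter> V)")
      case True
      then have "run A (val_oracle V (f s)) q [] = run A (val_oracle V f_sym) q []"
        using balanced[OF s] by (intro T(3)) (auto simp: val_oracle_def)
      then have "y s A = multilinear V (f s) x" by (simp add: y_def x_def)
      also have "\<dots> \<le> multilinear V (\<lambda>S. f_sym S + M * bad S s) x"
      proof (rule multilinear_mono)
        fix S assume "S \<subseteq> V"
        then show "f s S \<le> f_sym S + M * bad S s"
          using balanced[OF s, of S] range[OF s, of S] f_sym[of S] by (cases "bal s S") (auto simp: bad_def)
      qed (use P(1)[OF x] in auto)
      also have "\<dots> = multilinear V f_sym x + M * (\<Sum>S\<in>Pow V. rounding V x S * bad S s)"
        by (simp add: multilinear_add multilinear_cmult) (simp add: multilinear_rounding mult.commute)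
      also have "\<dots> \<le> \<beta> + M * ((\<Sum>S\<in>Pow V. rounding V x S * bad S s) + (\<Sum>Q\<in>T. bad (Q \<inter> V) s))"
        using P(2)[OF x] M bad0 by (intro add_mono mult_left_mono) (auto intro: sum_nonneg)
      finally show ?thesis .
    next
      case False
      then obtain Q where Q: "Q \<in> T" "\<not> bal s (Q \<inter> V)" by blast
      have "bad (Q \<inter> V) s \<le> (\<Sum>Q\<in>T. bad (Q \<inter> V) s)"
        using T(1) Q(1) bad0 by (intro member_le_sum) auto
      then have "1 \<le> (\<Sum>Q\<in>T. bad (Q \<inter> V) s)" using Q by (simp add: bad_def)
      moreover have "0 \<le> (\<Sum>S\<in>Pow V. rounding V x S * bad S s)"
        using rn bad0 by (intro sum_nonneg mult_nonneg_nonneg) auto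
      ultimately have "M * 1 \<le> M * ((\<Sum>S\<in>Pow V. rounding V x S * bad S s) + (\<Sum>Q\<in>T. bad (Q \<inter> V) s))"
        using M by (intro mult_left_mono) auto
      moreover have "y s A \<le> M" using y[OF A s] by simp
      moreover have "0 \<le> \<beta>"
      proof -
        have "multilinear V (\<lambda>_. 0) x \<le> multilinear V f_sym x"
          using f_sym P(1)[OF x] by (intro multilinear_mono) auto
        with P(2)[OF x] show ?thesis by (simp add: multilinear_const V)
      qed
      ultimately show ?thesis by simp
    qed
    have "measure_pmf.expectation D (\<lambda>s. y s A) \<le> measure_pmf.expectation D
        (\<lambda>s. \<beta> + M * ((\<Sum>S\<in>Pow V. rounding V x S * bad S s) + (\<Sum>Q\<in>T. bad (Q \<inter> V) s)))"
      using pointwise by (intro integral_mono_AE intD) (auto simp: AE_measure_pmf_iff)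
    also have "\<dots> = \<beta> + M * ((\<Sum>S\<in>Pow V. rounding V x S * measure_pmf.expectation D (bad S))
        + (\<Sum>Q\<in>T. measure_pmf.expectation D (bad (Q \<inter> V))))"
      by (simp add: intD)
    also have "\<dots> \<le> \<beta> + M * ((\<Sum>S\<in>Pow V. rounding V x S * \<delta>) + (\<Sum>Q\<in>T. \<delta>))"
      using M rn bad by (intro add_left_mono mult_left_mono add_mono sum_mono) auto
    also have "(\<Sum>S\<in>Pow V. rounding V x S * \<delta>) = \<delta>"
      using sum_rounding[OF V, of x] by (simp flip: sum_distrib_right)
    also have "\<beta> + M * (\<delta> + (\<Sum>Q\<in>T. \<delta>)) \<le> \<beta> + M * (\<delta> + real q * \<delta>)"
    proof -
      have "0 \<le> \<delta>" using rare[of "{}"] measure_nonneg[of "measure_pmf D"] by (meson empty_subsetI order.trans)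
      then show ?thesis using M T(2) by (intro add_left_mono mult_left_mono) (auto intro: mult_right_mono)
    qed
    finally show ?thesis by (simp add: algebra_simps)
  qed
  \<comment> \<open>If every instance gave more than \<open>?b\<close>, so would their average over
    \<open>D\<close>; exchanging it with the average over \<open>R\<close> contradicts
    \<open>per_algorithm\<close>.\<close>
  have "?b = (\<Sum>s\<in>set_pmf D. pmf D s * ?b)"
    using sum_pmf_eq_1[OF D] by (simp flip: sum_distrib_right)
  also have "\<dots> < (\<Sum>s\<in>set_pmf D. pmf D s * measure_pmf.expectation R (y s))"
    using D set_pmf_not_empty[of D] large
    by (intro sum_strict_mono mult_strict_left_mono) (auto simp: pmf_positive)
  also have "\<dots> = measure_pmf.expectation R (\<lambda>A. \<Sum>s\<in>set_pmf D. pmf D s * y s A)"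
    by (subst Bochner_Integration.integral_sum) (auto simp: int)
  also have "\<dots> \<le> measure_pmf.expectation R (\<lambda>A. ?b)"
  proof (rule integral_mono_AE)
    show "AE A in measure_pmf R. (\<Sum>s\<in>set_pmf D. pmf D s * y s A) \<le> ?b"
      unfolding AE_measure_pmf_iff using per_algorithm D
      by (subst (asm) integral_measure_pmf[OF D]) auto
  qed (auto intro!: Bochner_Integration.integrable_sum int)
  also have "\<dots> = ?b" by simp
  finally show False by simp
qed

section \<open>The hard instances\<close>

text \<open>The fewer than \<open>2 * k\<close> elements left over at the end of the ground set are ignored by the
  objective. They join side 0, where choosing them can only waste the quota.\<close>
definition side :: "nat \<Rightarrow> nat \<Rightarrow> nat \<Rightarrow> nat" where
  "side k m i = (if k * m \<le> i \<and> i < 2 * (k * m) then 1 else 0)"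

definition quota :: "nat \<Rightarrow> nat \<Rightarrow> nat \<Rightarrow> nat" where
  "quota k m c = (if c = 0 then m else (k - 1) * m)"

definition exact_sets :: "nat \<Rightarrow> nat \<Rightarrow> nat \<Rightarrow> nat set set" where
  "exact_sets k m n = {S. S \<subseteq> {..<n} \<and> card {x\<in>S. side k m x = 0} = m \<and> card {x\<in>S. side k m x = 1} = (k - 1) * m}"

lemma finite_exact_sets: "finite (exact_sets k m n)"
  by (rule finite_subset[of _ "Pow {..<n}"]) (auto simp: exact_sets_def)

lemma card_sides:
  assumes "finite S"
  shows "card S = card {x\<in>S. side k m x = 0} + card {x\<in>S. side k m x = 1}"
proof -
  have "S = {x\<in>S. side k m x = 0} \<union> {x\<in>S. side k m x = 1}" by (auto simp: side_def)
  then have "card S = card ({x\<in>S. side k m x = 0} \<union> {x\<in>S. side k m x = 1})" by simp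
  also have "\<dots> = card {x\<in>S. side k m x = 0} + card {x\<in>S. side k m x = 1}"
    using assms by (intro card_Un_disjoint) auto
  finally show ?thesis .
qed

text \<open>For the exchange property, block sizes add up to the cardinality, so the smaller set has
  fewer elements than the larger one in some block, and that block still has room.\<close>

lemma matroid_partition:
  assumes V: "finite V" and blk: "\<And>x. x \<in> V \<Longrightarrow> blk x \<in> B" and B: "finite B"
  shows "matroid V {X. X \<subseteq> V \<and> (\<forall>b::nat. card {x\<in>X. blk x = b} \<le> k b)}"
  unfolding matroid_def
proof (intro conjI ballI allI impI)
  fix X Y assume X: "X \<in> {X. X \<subseteq> V \<and> (\<forall>b. card {x\<in>X. blk x = b} \<le> k b)}" and "Y \<subseteq> X"
  have "card {x\<in>Y. blk x = b} \<le> card {x\<in>X. blk x = b}" for b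
    using X \<open>Y \<subseteq> X\<close> V by (intro card_mono) (auto intro: finite_subset)
  with X \<open>Y \<subseteq> X\<close> show "Y \<in> {X. X \<subseteq> V \<and> (\<forall>b. card {x\<in>X. blk x = b} \<le> k b)}"
    using le_trans by blast
next
  fix X Y assume X: "X \<in> {X. X \<subseteq> V \<and> (\<forall>b. card {x\<in>X. blk x = b} \<le> k b)}"
    and Y: "Y \<in> {X. X \<subseteq> V \<and> (\<forall>b. card {x\<in>X. blk x = b} \<le> k b)}" and less: "card X < card Y"
  have split: "card Z = (\<Sum>b\<in>B. card {x\<in>Z. blk x = b})" if "Z \<subseteq> V" for Z
  proof -
    have "finite Z" "blk ` Z \<subseteq> B" using that V blk by (auto intro: finite_subset)
    with sum.group[of Z B blk "\<lambda>_. 1::nat"] B show ?thesis by simp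
  qed
  have "\<exists>b\<in>B. card {x\<in>X. blk x = b} < card {x\<in>Y. blk x = b}"
  proof (rule ccontr)
    assume "\<not> ?thesis"
    then have "card Y \<le> card X"
      using X Y by (subst (1 2) split) (auto intro!: sum_mono simp: not_less)
    with less show False by simp
  qed
  then obtain b where b: "card {x\<in>X. blk x = b} < card {x\<in>Y. blk x = b}" by blast
  have fin: "finite X" using X V by (auto intro: finite_subset)
  have "\<not> {x\<in>Y. blk x = b} \<subseteq> {x\<in>X. blk x = b}"
    using b fin card_mono[of "{x\<in>X. blk x = b}" "{x\<in>Y. blk x = b}"] by auto
  then obtain e where e: "e \<in> Y" "e \<notin> X" "blk e = b" by blast
  have "card {x\<in>insert e X. blk x = c} \<le> k c" for c
  proof (cases "c = b")
    case True
    then have "{x\<in>insert e X. blk x = c} = insert e {x\<in>X. blk x = b}" using e by auto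
    then have "card {x\<in>insert e X. blk x = c} = Suc (card {x\<in>X. blk x = b})" using e fin by simp
    also have "\<dots> \<le> card {x\<in>Y. blk x = b}" using b by simp
    also have "\<dots> \<le> k c" using Y True by auto
    finally show ?thesis .
  next
    case False
    then have "{x\<in>insert e X. blk x = c} = {x\<in>X. blk x = c}" using e by auto
    then show ?thesis using X by simp
  qed
  then show "\<exists>e\<in>Y - X. insert e X \<in> {X. X \<subseteq> V \<and> (\<forall>b. card {x\<in>X. blk x = b} \<le> k b)}"
    using e X Y by blast
qed auto

text \<open>The sides are the two colors. The power set is a matroid as the instance of
  \<open>matroid_partition\<close> with a single block of capacity \<open>n\<close>.\<close>

lemma special_case_i_exact_sets:
  assumes "exact_sets k m n \<noteq> {}"
  shows "\<exists>I C col l u. special_case_i {..<n} I C \<and> valid_structure {..<n} I C col l u \<and>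
    feasible_sets {..<n} I C col l u = exact_sets k m n"
proof -
  have eq: "feasible_sets {..<n} (Pow {..<n}) 2 (side k m) (quota k m) (quota k m) = exact_sets k m n"
    by (auto simp: feasible_sets_def fair_sets_def exact_sets_def quota_def less_2_cases_iff)
  have "matroid {..<n} {X. X \<subseteq> {..<n} \<and> (\<forall>b::nat. card {x\<in>X. 0 = b} \<le> n)}"
    by (rule matroid_partition[where B = "{0}"]) auto
  moreover have "card {x\<in>X. 0 = b} \<le> n" if "X \<subseteq> {..<n}" for X and b :: nat
    using card_mono[of "{..<n}" "{x\<in>X. 0 = b}"] that by auto
  then have "{X. X \<subseteq> {..<n} \<and> (\<forall>b::nat. card {x\<in>X. 0 = b} \<le> n)} = Pow {..<n}" by blast
  ultimately have "valid_structure {..<n} (Pow {..<n}) 2 (side k m) (quota k m) (quota k m)"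
    using assms by (auto simp: valid_structure_def eq side_def)
  with eq show ?thesis
    by (intro exI[of _ "Pow {..<n}"] exI[of _ 2]) (auto simp: special_case_i_def)
qed

text \<open>The block capacities \<open>m\<close> and \<open>(k - 1) * m\<close> add up to
  \<open>k * m\<close>, the size forced by the only color, so both capacities must be
  attained.\<close>

lemma special_case_ii_exact_sets:
  assumes "exact_sets k m n \<noteq> {}" "k \<ge> 1"
  shows "\<exists>I C col l u. special_case_ii {..<n} I C \<and> valid_structure {..<n} I C col l u \<and>
    feasible_sets {..<n} I C col l u = exact_sets k m n"
proof -
  define I where "I = {X. X \<subseteq> {..<n} \<and> (\<forall>b. card {x\<in>X. side k m x = b} \<le> quota k m b)}"
  have q: "quota k m 0 = m" "quota k m 1 = (k - 1) * m" "quota k m (Suc 0) = (k - 1) * m" by (auto simp: quota_def)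
  have km: "k * m = m + (k - 1) * m" using assms(2) by (simp add: diff_mult_distrib)
  have eq: "feasible_sets {..<n} I 1 (\<lambda>_. 0) (\<lambda>_. k * m) (\<lambda>_. k * m) = exact_sets k m n"
  proof (intro set_eqI iffI)
    fix S assume "S \<in> feasible_sets {..<n} I 1 (\<lambda>_. 0) (\<lambda>_. k * m) (\<lambda>_. k * m)"
    then have S: "S \<subseteq> {..<n}" "card S = k * m" "\<And>b. card {x\<in>S. side k m x = b} \<le> quota k m b"
      by (auto simp: feasible_sets_def fair_sets_def I_def)
    from S(1) have "finite S" by (auto intro: finite_subset)
    from card_sides[OF this, of k m] S(2) S(3)[of 0] S(3)[of 1] show "S \<in> exact_sets k m n"
      using S(1) by (simp add: exact_sets_def q km)
  next
    fix S assume S: "S \<in> exact_sets k m n"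
    then have fin: "finite S" by (auto simp: exact_sets_def intro: finite_subset)
    have "card {x\<in>S. side k m x = b} \<le> quota k m b" for b
    proof -
      have empty: "{x\<in>S. side k m x = b} = {}" if "b \<noteq> 0" "b \<noteq> 1" using that by (auto simp: side_def)
      have "card {x\<in>S. side k m x = b} = 0" if "b \<noteq> 0" "b \<noteq> 1"
        unfolding empty[OF that] by simp
      with S show ?thesis by (cases "b = 0 \<or> b = 1") (auto simp: exact_sets_def quota_def)
    qed
    moreover have "card S = k * m" using card_sides[OF fin, of k m] S by (simp add: exact_sets_def km)
    ultimately show "S \<in> feasible_sets {..<n} I 1 (\<lambda>_. 0) (\<lambda>_. k * m) (\<lambda>_. k * m)"
      using S by (auto simp: feasible_sets_def fair_sets_def I_def exact_sets_def)
  qed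
  have "matroid {..<n} I"
    unfolding I_def by (rule matroid_partition[where B = "{0, 1}"]) (auto simp: side_def)
  then have "valid_structure {..<n} I 1 (\<lambda>_. 0) (\<lambda>_. k * m) (\<lambda>_. k * m)"
    unfolding valid_structure_def eq using assms by auto
  moreover have "special_case_ii {..<n} I 1"
    unfolding special_case_ii_def partition_matroid_def I_def by blast
  ultimately show ?thesis using eq by blast
qed

text \<open>The set \<open>A1 \<union> B2\<close> of the partition drawn by
  \<open>s\<close>.\<close>

definition optimum :: "nat \<Rightarrow> nat \<Rightarrow> (nat \<Rightarrow> nat) \<Rightarrow> nat set" where
  "optimum k m s = transversal k m s \<union> (+) (k * m) ` ({..<k * m} - transversal k m s)"

lemma optimum_exact:
  assumes "\<And>j. j < m \<Longrightarrow> s j < k" "2 * (k * m) \<le> n"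
  shows "optimum k m s \<in> exact_sets k m n"
proof -
  let ?T = "transversal k m s"
  have T: "?T \<subseteq> {..<k * m}" "card ?T = m"
    using transversal_subset[of m s k] card_transversal[of m s k] assms(1) by auto
  have "{x \<in> optimum k m s. side k m x = 0} = ?T"
    "{x \<in> optimum k m s. side k m x = 1} = (+) (k * m) ` ({..<k * m} - ?T)"
    using T by (auto simp: optimum_def side_def)
  moreover have "card ((+) (k * m) ` ({..<k * m} - ?T)) = (k - 1) * m"
    using T by (subst card_image, simp, subst card_Diff_subset)
      (auto intro: finite_subset simp: diff_mult_distrib)
  moreover have "optimum k m s \<subseteq> {..<n}" using T assms(2) by (force simp: optimum_def)
  ultimately show ?thesis using T by (simp add: exact_sets_def)
qed

text \<open>Among the \<open>k\<close> constant shifts, an element of the first side is chosen only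
  by its own residue, one of the second side by every residue except its own, and a leftover element
  never. So each element is missed at least once.\<close>

lemma const_optimum_avoids:
  assumes k: "k \<ge> 2"
  obtains p where "p < k" "i \<notin> optimum k m (\<lambda>_. p)"
proof -
  consider "i < k * m" | "k * m \<le> i" "i < 2 * (k * m)" | "i \<ge> 2 * (k * m)" by linarith
  then show ?thesis
  proof cases
    case 1
    define p where "p = (if i mod k = 0 then 1 else 0 :: nat)"
    have "p < k" "p \<noteq> i mod k" using k by (auto simp: p_def)
    then have "i \<notin> transversal k m (\<lambda>_. p)" by (auto simp: transversal_def)
    with 1 \<open>p < k\<close> show ?thesis by (intro that[of p]) (auto simp: optimum_def)
  next
    case 2
    define d where "d = i - k * m"
    have d: "d < k * m" "i = k * m + d" using 2 by (auto simp: d_def)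
    then have "d div k < m" using k by (simp add: div_less_iff_less_mult mult.commute)
    then have "d \<in> transversal k m (\<lambda>_. d mod k)"
      unfolding transversal_def by (intro image_eqI[of _ _ "d div k"]) auto
    moreover have "transversal k m (\<lambda>_. d mod k) \<subseteq> {..<k * m}"
      using k by (intro transversal_subset) auto
    ultimately show ?thesis
      using d k by (intro that[of "d mod k"]) (auto simp: optimum_def)
  next
    case 3
    have "transversal k m (\<lambda>_. 0) \<subseteq> {..<k * m}"
      using k by (intro transversal_subset) auto
    with 3 k show ?thesis by (intro that[of 0]) (auto simp: optimum_def)
  qed
qed

text \<open>The witness is the average of the optima for the \<open>k\<close> constant shifts: every
  coordinate lacks at least one of the \<open>k\<close> summands \<open>1 / k\<close>.
  \<open>P\<close> stands for the complemented polytope.\<close>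

lemma INF_linf_le:
  assumes k: "k \<ge> 2" and m: "m \<ge> 1" and n: "2 * (k * m) \<le> n"
  shows "(INF x\<in>polytope (exact_sets k m n) \<union> P. linf {..<n} x) \<le> 1 - 1 / real k"
proof -
  define x where "x = (\<lambda>i. \<Sum>p<k. (1 / real k) * indic_vec (optimum k m (\<lambda>_. p)) i)"
  have x: "x \<in> polytope (exact_sets k m n)"
    unfolding x_def using k n by (intro mixture_in_polytope finite_exact_sets optimum_exact) auto
  have "0 < k * m" using k m by simp
  with n have "0 < n" by linarith
  then have V: "{..<n} \<noteq> {}" by (auto simp: lessThan_empty_iff)
  have "\<bar>x i\<bar> \<le> 1 - 1 / real k" for i
  proof -
    obtain p where p: "p < k" "i \<notin> optimum k m (\<lambda>_. p)" using const_optimum_avoids[OF k] .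
    have "x i = (\<Sum>q\<in>{..<k} - {p}. (1 / real k) * indic_vec (optimum k m (\<lambda>_. q)) i)"
      unfolding x_def using p by (subst sum.remove[of "{..<k}" p]) (auto simp: indic_vec_def)
    also have "\<dots> \<le> (\<Sum>q\<in>{..<k} - {p}. 1 / real k)"
      by (intro sum_mono) (auto simp: indic_vec_def)
    also have "\<dots> = 1 - 1 / real k" using p k by (simp add: of_nat_diff field_simps)
    finally show ?thesis using polytope_range[OF x, of i] by simp
  qed
  then have "linf {..<n} x \<le> 1 - 1 / real k"
    unfolding linf_def using V by (intro cSUP_least) auto
  moreover have "(INF x\<in>polytope (exact_sets k m n) \<union> P. linf {..<n} x) \<le> linf {..<n} x"
  proof (rule cINF_lower)
    have "0 \<le> linf {..<n} y" for y
    proof -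
      obtain i where i: "i \<in> {..<n}" using V by blast
      have "0 \<le> \<bar>y i\<bar>" by simp
      also have "\<dots> \<le> linf {..<n} y" unfolding linf_def using i by (intro cSUP_upper) auto
      finally show ?thesis .
    qed
    then show "bdd_below (linf {..<n} ` (polytope (exact_sets k m n) \<union> P))" by (intro bdd_belowI[of _ 0]) auto
  qed (use x in simp)
  ultimately show ?thesis by linarith
qed

text \<open>Up to scaling, the symmetrization counts all arcs from the first side to the second, so
  its extension factorizes into a product of two linear forms, each at most \<open>m\<close> on the
  polytope. This is why the gap persists for fractional points.\<close>

lemma multilinear_symmetric_le:
  assumes k: "k \<ge> 2" and m: "m \<ge> 1" and n: "2 * (k * m) \<le> n" and "\<rho> \<ge> 0"
    and x: "x \<in> polytope (exact_sets k m n)"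
  shows "multilinear {..<n} (\<lambda>S. cut_value k \<rho> (\<lambda>_ _. 0)
      (fill_ratio k m {..<k * m} S) (fill_ratio k m {k * m..<2 * (k * m)} S) 0 0) x \<le> 1 / real k + 4 * \<rho>"
proof -
  let ?A = "{..<k * m}" and ?B = "{k * m..<2 * (k * m)}"
  define h where "h = 1 / (real k * (real m)\<^sup>2)"
  have h: "h \<ge> 0" by (simp add: h_def)
  have pos: "real k > 0" "real m > 0" using k m by auto
  \<comment> \<open>Only an upper bound, since leftover elements share the quota of side 0.\<close>
  have sumA: "(\<Sum>i\<in>?A. x i) \<le> real m"
  proof (rule polytope_sum[OF x])
    fix S assume S: "S \<in> exact_sets k m n"
    then have "finite S" by (auto simp: exact_sets_def intro: finite_subset)
    then have "card (S \<inter> ?A) \<le> card {x\<in>S. side k m x = 0}" by (intro card_mono) (auto simp: side_def)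
    then show "real (card (S \<inter> ?A)) \<le> real m" using S by (simp add: exact_sets_def)
  qed simp
  have sumB: "real ((k - 1) * m) \<le> (\<Sum>i\<in>?B. x i)"
  proof (rule polytope_sum_ge[OF x])
    fix S assume S: "S \<in> exact_sets k m n"
    have "S \<inter> ?B = {x\<in>S. side k m x = 1}" by (auto simp: side_def)
    then show "real ((k - 1) * m) \<le> real (card (S \<inter> ?B))" using S by (simp add: exact_sets_def)
  qed simp
  have le: "cut_value k \<rho> (\<lambda>_ _. 0) (fill_ratio k m ?A S) (fill_ratio k m ?B S) 0 0
      \<le> h * (\<Sum>a\<in>?A. \<Sum>b\<in>?B. of_bool (a \<in> S) * of_bool (b \<notin> S)) + 4 * \<rho>" for S
  proof -
    have a: "(\<Sum>a\<in>?A. of_bool (a \<in> S)) = real (card (S \<inter> ?A))"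
      by (simp add: of_bool_def sum.If_cases Int_commute)
    have "card (?B \<inter> - S) = card (?B - ?B \<inter> S)" by (intro arg_cong[where f = card]) auto
    also have "\<dots> = k * m - card (?B \<inter> S)" by (subst card_Diff_subset) auto
    finally have "card (?B \<inter> - S) = k * m - card (S \<inter> ?B)" by (simp add: Int_commute)
    moreover have "card (S \<inter> ?B) \<le> k * m" using card_mono[of ?B "S \<inter> ?B"] by simp
    ultimately have b: "(\<Sum>b\<in>?B. of_bool (b \<notin> S)) = real k * real m - real (card (S \<inter> ?B))"
      by (simp add: of_bool_def sum.If_cases of_nat_diff Compl_eq)
    have "h * (\<Sum>a\<in>?A. \<Sum>b\<in>?B. of_bool (a \<in> S) * of_bool (b \<notin> S))
        = h * (real (card (S \<inter> ?A)) * (real k * real m - real (card (S \<inter> ?B))))"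
      unfolding sum_product[symmetric] a b ..
    also have "\<dots> = real k * fill_ratio k m ?A S * (1 - fill_ratio k m ?B S)"
      using pos by (simp add: h_def fill_ratio_def field_simps power2_eq_square)
    finally have "h * (\<Sum>a\<in>?A. \<Sum>b\<in>?B. of_bool (a \<in> S) * of_bool (b \<notin> S))
        = real k * fill_ratio k m ?A S * (1 - fill_ratio k m ?B S)" .
    moreover have "\<rho> * (4 - (fill_ratio k m ?A S + fill_ratio k m ?B S)\<^sup>2) \<le> \<rho> * 4"
      using \<open>\<rho> \<ge> 0\<close> by (intro mult_left_mono) auto
    ultimately show ?thesis by (simp add: cut_value_def)
  qed
  have "multilinear {..<n} (\<lambda>S. cut_value k \<rho> (\<lambda>_ _. 0) (fill_ratio k m ?A S) (fill_ratio k m ?B S) 0 0) x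
     \<le> multilinear {..<n} (\<lambda>S. h * (\<Sum>a\<in>?A. \<Sum>b\<in>?B. of_bool (a \<in> S) * of_bool (b \<notin> S)) + 4 * \<rho>) x"
    using polytope_range[OF x] le by (intro multilinear_mono) auto
  also have "\<dots> = h * (\<Sum>a\<in>?A. \<Sum>b\<in>?B. multilinear {..<n} (\<lambda>S. of_bool (a \<in> S) * of_bool (b \<notin> S)) x) + 4 * \<rho>"
    by (simp only: multilinear_add multilinear_cmult multilinear_sum multilinear_const finite_lessThan)
  also have "(\<Sum>a\<in>?A. \<Sum>b\<in>?B. multilinear {..<n} (\<lambda>S. of_bool (a \<in> S) * of_bool (b \<notin> S)) x)
      = (\<Sum>a\<in>?A. \<Sum>b\<in>?B. x a * (1 - x b))"
    using n by (intro sum.cong multilinear_arc) auto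
  also have "\<dots> = (\<Sum>a\<in>?A. x a) * (real k * real m - (\<Sum>b\<in>?B. x b))"
    unfolding sum_product[symmetric] by (simp add: sum_subtractf)
  also have "\<dots> \<le> real m * real m"
  proof (rule mult_mono)
    show "real k * real m - (\<Sum>b\<in>?B. x b) \<le> real m"
      using sumB k by (simp add: of_nat_diff algebra_simps)
    have "(\<Sum>b\<in>?B. x b) \<le> (\<Sum>b\<in>?B. 1)" using polytope_range[OF x] by (intro sum_mono) auto
    then show "0 \<le> real k * real m - (\<Sum>b\<in>?B. x b)" by simp
  qed (use sumA in auto)
  also have "h * (real m * real m) = 1 / real k"
    using pos by (simp add: h_def power2_eq_square)
  finally show ?thesis using h by (simp add: mult_left_mono)
qed

text \<open>\<open>val\<close> sends an output to a point of the polytope: \<open>indic_vec\<close>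
  in the discrete problem, the identity in the continuous one.\<close>

lemma hard_instance_exact_sets:
  fixes R :: "'o algorithm pmf"
  assumes k: "k \<ge> 2" and m: "m \<ge> 1" and n: "2 * (k * m) \<le> n"
    and w: "flat_weight \<kappa> \<gamma> w" "w 1 (-1) = 1" and "\<kappa> \<ge> 0" "\<gamma> \<ge> 0" "\<kappa> * (real k)\<^sup>2 \<le> \<rho>"
    and out: "\<And>A f. A \<in> set_pmf R \<Longrightarrow> nonneg_submodular {..<n} f \<Longrightarrow>
      val (the (run A (val_oracle {..<n} f) q [])) \<in> polytope (exact_sets k m n)"
  shows "\<exists>f. nonneg_submodular {..<n} f \<and> (\<exists>S\<in>exact_sets k m n. 1 \<le> f S) \<and>
      (\<forall>S\<subseteq>{..<n}. f S \<le> real k + 4 * \<rho>) \<and>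
      measure_pmf.expectation R (\<lambda>A. multilinear {..<n} f (val (the (run A (val_oracle {..<n} f) q []))))
      \<le> 1 / real k + 4 * \<rho> + (real k + 4 * \<rho>) * (1 + real q) * (4 * exp (- (\<gamma> * real m / 4)))"
proof -
  define A1 where "A1 = transversal k m"
  define A2 where "A2 = (\<lambda>s. {..<k * m} - A1 s)"
  define B1 where "B1 = (\<lambda>s. (+) (k * m) ` A1 s)"
  define B2 where "B2 = (\<lambda>s. (+) (k * m) ` A2 s)"
  define f where "f = (\<lambda>s. hidden_cut k m \<rho> w (A1 s) (A2 s) (B1 s) (B2 s))"
  define f0 where "f0 = (\<lambda>S. cut_value k \<rho> (\<lambda>_ _. 0)
      (fill_ratio k m {..<k * m} S) (fill_ratio k m {k * m..<2 * (k * m)} S) 0 0)"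
  have "0 \<le> \<kappa> * (real k)\<^sup>2" using assms by simp
  with assms have "\<rho> \<ge> 0" by linarith
  have part: "hidden_partition {..<n} (A1 s) (A2 s) (B1 s) (B2 s) k m" if "s \<in> set_pmf (shifts k m)" for s
    unfolding A1_def A2_def B1_def B2_def using n
    by (intro hidden_partition_transversal k m that) auto
  have less: "s j < k" if "s \<in> set_pmf (shifts k m)" "j < m" for s j
    using shifts_less[OF _ that] k by simp
  \<comment> \<open>Without the weight only the unions of the parts enter, and these do not depend
    on \<open>s\<close>.\<close>
  have f0_eq: "hidden_cut k m \<rho> (\<lambda>_ _. 0) (A1 s) (A2 s) (B1 s) (B2 s) = f0"
    if s: "s \<in> set_pmf (shifts k m)" for s
  proof -
    have "A1 s \<subseteq> {..<k * m}" unfolding A1_def using less[OF s] by (intro transversal_subset)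
    then have A: "A1 s \<union> A2 s = {..<k * m}" by (auto simp: A2_def)
    have "B1 s \<union> B2 s = (+) (k * m) ` (A1 s \<union> A2 s)" by (auto simp: B1_def B2_def)
    also have "\<dots> = {k * m..<2 * (k * m)}"
      unfolding A lessThan_atLeast0 by (simp add: image_add_atLeastLessThan mult_2)
    finally show ?thesis using A by (auto simp: hidden_cut_def f0_def cut_value_def)
  qed
  \<comment> \<open>The zero weight is flat as well, which makes the symmetrized function a
    legitimate instance; the guarantee \<open>out\<close> then also covers the run on it.\<close>
  have zero: "flat_weight \<kappa> \<gamma> (\<lambda>_ _. 0)"
    using \<open>\<kappa> \<ge> 0\<close> by (auto simp: flat_weight_def intro!: exI[of _ 0])
  have sub: "nonneg_submodular {..<n} (f s)" "nonneg_submodular {..<n} f0"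
    if s: "s \<in> set_pmf (shifts k m)" for s
    using hidden_partition.nonneg_submodular_hidden_cut[OF part[OF s]] w zero assms f0_eq[OF s]
    unfolding f_def by metis+
  obtain s0 where s0: "s0 \<in> set_pmf (shifts k m)" using set_pmf_not_empty by fast
  note bounds = hidden_partition.hidden_cut_bounds[OF part w(1) \<open>\<rho> \<ge> 0\<close>]
  have "\<exists>s\<in>set_pmf (shifts k m). measure_pmf.expectation R
      (\<lambda>A. multilinear {..<n} (f s) (val (the (run A (val_oracle {..<n} (f s)) q []))))
      \<le> 1 / real k + 4 * \<rho> + (real k + 4 * \<rho>) * (1 + real q) * (4 * exp (- (\<gamma> * real m / 4)))"
  proof (rule hard_instance_exists[where f_sym = f0 and P = "polytope (exact_sets k m n)" and
        bal = "\<lambda>s S. (imbalance k m (A1 s) (A2 s) S)\<^sup>2 + (imbalance k m (B1 s) (B2 s) S)\<^sup>2 \<le> \<gamma>"])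
    show "finite (set_pmf (shifts k m))" using k by (intro finite_set_shifts) simp
    show "f s S \<in> {0..real k + 4 * \<rho>}" if "s \<in> set_pmf (shifts k m)" for s S
      using bounds[OF that] by (simp add: f_def)
    show "0 \<le> f0 S" if "S \<subseteq> {..<n}" for S
      using sub(2)[OF s0] that by (simp add: nonneg_submodular_def)
    show "f s S = f0 S" if "s \<in> set_pmf (shifts k m)"
      "(imbalance k m (A1 s) (A2 s) S)\<^sup>2 + (imbalance k m (B1 s) (B2 s) S)\<^sup>2 \<le> \<gamma>" for s S
      using hidden_partition.hidden_cut_balanced[OF part[OF that(1)] w(1) that(2)] f0_eq[OF that(1)]
      by (simp add: f_def)
    show "measure_pmf.prob (shifts k m)
      {s. \<not> (imbalance k m (A1 s) (A2 s) S)\<^sup>2 + (imbalance k m (B1 s) (B2 s) S)\<^sup>2 \<le> \<gamma>}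
      \<le> 4 * exp (- (\<gamma> * real m / 4))" for S
      unfolding A1_def A2_def B1_def B2_def using \<open>\<gamma> \<ge> 0\<close> by (intro unbalanced_prob k m)
    show "x i \<in> {0..1}" if "x \<in> polytope (exact_sets k m n)" for x i using that by (rule polytope_range)
    show "multilinear {..<n} f0 x \<le> 1 / real k + 4 * \<rho>" if "x \<in> polytope (exact_sets k m n)" for x
      unfolding f0_def using k m n \<open>\<rho> \<ge> 0\<close> that by (rule multilinear_symmetric_le)
  qed (auto intro: out sub(1) sub(2)[OF s0])
  then obtain s where s: "s \<in> set_pmf (shifts k m)" and val: "measure_pmf.expectation R
      (\<lambda>A. multilinear {..<n} (f s) (val (the (run A (val_oracle {..<n} (f s)) q []))))
      \<le> 1 / real k + 4 * \<rho> + (real k + 4 * \<rho>) * (1 + real q) * (4 * exp (- (\<gamma> * real m / 4)))" by blast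
  have "optimum k m s \<in> exact_sets k m n" using n less[OF s] by (intro optimum_exact) auto
  moreover have "1 \<le> f s (optimum k m s)"
    using hidden_partition.hidden_cut_optimum[OF part[OF s], of w \<rho>] w(2) \<open>\<rho> \<ge> 0\<close>
    by (simp add: f_def optimum_def A1_def A2_def B2_def)
  ultimately show ?thesis using sub(1)[OF s] val bounds(2)[OF s] by (auto simp: f_def)
qed

section \<open>Choice of constants and the final lower bounds\<close>

lemma exponential_query_budget:
  fixes \<gamma> \<epsilon> :: real and k :: nat
  assumes "\<gamma> > 0" "\<epsilon> > 0" "k \<ge> 1"
  shows "\<exists>c>0. \<exists>N. \<forall>n\<ge>N. \<forall>q. n div (2 * k) \<ge> 1 \<and> (real q < exp (c * real n) \<longrightarrow>
     (real k + 4) * (1 + real q) * (4 * exp (- (\<gamma> * real (n div (2 * k)) / 4))) < \<epsilon>)"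
proof -
  \<comment> \<open>The failure probability decays like
    \<open>exp (- \<gamma> * n / (8 * k))\<close>, which is \<open>exp (- 2 * c * n)\<close>: one
    half of the exponent pays for the queries, the other half makes the product small.\<close>
  define c where "c = \<gamma> / (16 * real k)"
  have c: "c > 0" using assms by (simp add: c_def)
  define K where "K = 8 * (real k + 4) * exp (\<gamma> / 4)"
  have K: "K > 0" by (simp add: K_def add_pos_pos)
  \<comment> \<open>From \<open>exp y > y\<close>, a bound
    \<open>n \<ge> K / (c * \<epsilon>)\<close> yields
    \<open>K * exp (- (c * n)) < \<epsilon>\<close>; the factor \<open>exp (\<gamma> / 4)\<close> in
    \<open>K\<close> compensates for rounding \<open>n / (2 * k)\<close> down.\<close>
  define N where "N = max (2 * k) (nat \<lceil>K / (c * \<epsilon>)\<rceil>)"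
  have "n div (2 * k) \<ge> 1 \<and> (real q < exp (c * real n) \<longrightarrow>
     (real k + 4) * (1 + real q) * (4 * exp (- (\<gamma> * real (n div (2 * k)) / 4))) < \<epsilon>)" if n: "n \<ge> N" for n q
  proof (intro conjI impI)
    have "n \<ge> 2 * k" using n by (simp add: N_def)
    then show "n div (2 * k) \<ge> 1" using assms div_le_mono[of "2 * k" n "2 * k"] by simp
    assume q: "real q < exp (c * real n)"
    have "n < 2 * k * (n div (2 * k)) + 2 * k"
      using assms by (metis add_less_cancel_left mod_less_divisor mult_div_mod_eq mult_pos_pos pos2 zero_less_one order_less_le_trans)
    then have "real n < real (2 * k * (n div (2 * k)) + 2 * k)" by (simp only: of_nat_less_iff)
    then have "real n / (2 * real k) \<le> real (n div (2 * k)) + 1"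
      using assms by (simp add: field_simps)
    then have "\<gamma> / 4 * (real n / (2 * real k)) \<le> \<gamma> / 4 * (real (n div (2 * k)) + 1)"
      using assms by (intro mult_left_mono) auto
    then have "- (\<gamma> * real (n div (2 * k)) / 4) \<le> \<gamma> / 4 + - (2 * c * real n)"
      using assms by (simp add: c_def algebra_simps)
    then have e: "exp (- (\<gamma> * real (n div (2 * k)) / 4)) \<le> exp (\<gamma> / 4) * exp (- (2 * c * real n))"
      by (simp flip: exp_add)
    have "1 \<le> exp (c * real n)" using c by simp
    with q have "1 + real q \<le> 2 * exp (c * real n)" by linarith
    then have "(real k + 4) * (1 + real q) * (4 * exp (- (\<gamma> * real (n div (2 * k)) / 4)))
       \<le> (real k + 4) * (2 * exp (c * real n)) * (4 * (exp (\<gamma> / 4) * exp (- (2 * c * real n))))"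
      using e by (intro mult_mono) auto
    also have "\<dots> = K * (exp (c * real n) * exp (- (2 * c * real n)))" by (simp add: K_def)
    also have "exp (c * real n) * exp (- (2 * c * real n)) = exp (- (c * real n))"
      by (simp flip: exp_add)
    also have "K * exp (- (c * real n)) < \<epsilon>"
    proof -
      have "K / (c * \<epsilon>) \<le> real n" using n by (auto simp: N_def nat_le_iff ceiling_le_iff)
      then have "K \<le> \<epsilon> * (c * real n)" using c assms by (simp add: field_simps)
      also have "\<dots> < \<epsilon> * exp (c * real n)"
        using assms exp_ge_add_one_self[of "c * real n"] by (intro mult_strict_left_mono) linarith+
      finally show ?thesis by (simp add: exp_minus field_simps)
    qed
    finally show "(real k + 4) * (1 + real q) * (4 * exp (- (\<gamma> * real (n div (2 * k)) / 4))) < \<epsilon>" .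
  qed
  with c show ?thesis by blast
qed

text \<open>The constants are fixed in the order \<open>\<epsilon>\<close>, \<open>\<rho>\<close>,
  \<open>\<kappa>\<close>, \<open>\<gamma>\<close>, then \<open>c\<close> and \<open>N\<close>, none
  depending on \<open>n\<close>. The bound \<open>b\<close> guarantees later that the supremum in
  the continuous problem is over a bounded set.\<close>

lemma exact_sets_hard:
  fixes \<epsilon> :: real
  assumes k: "k \<ge> 2" and "\<epsilon> > 0"
  obtains c N where "c > 0" "\<And>n. n \<ge> N \<Longrightarrow> n div (2 * k) \<ge> 1"
    "\<And>n q (R :: 'o algorithm pmf) val. n \<ge> N \<Longrightarrow> real q < exp (c * real n) \<Longrightarrow>
      (\<And>A f. A \<in> set_pmf R \<Longrightarrow> nonneg_submodular {..<n} f \<Longrightarrow>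
        val (the (run A (val_oracle {..<n} f) q [])) \<in> polytope (exact_sets k (n div (2 * k)) n)) \<Longrightarrow>
      \<exists>f b. nonneg_submodular {..<n} f \<and> (\<exists>S\<in>exact_sets k (n div (2 * k)) n. 1 \<le> f S) \<and>
        (\<forall>S\<subseteq>{..<n}. f S \<le> b) \<and>
        measure_pmf.expectation R (\<lambda>A. multilinear {..<n} f (val (the (run A (val_oracle {..<n} f) q []))))
        < 1 / real k + \<epsilon>"
proof -
  \<comment> \<open>\<open>4 * \<rho> \<le> \<epsilon> / 2\<close> leaves the other half of
    \<open>\<epsilon>\<close> to the failure probability, and \<open>\<rho> \<le> 1\<close> bounds
    the values by \<open>k + 4\<close>.\<close>
  define \<rho> where "\<rho> = min 1 (\<epsilon> / 8)"
  have \<rho>: "0 < \<rho>" "\<rho> \<le> 1" "\<rho> \<le> \<epsilon> / 8" using assms by (auto simp: \<rho>_def)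
  define \<kappa> where "\<kappa> = \<rho> / (real k)\<^sup>2"
  have \<kappa>: "\<kappa> > 0" "\<kappa> * (real k)\<^sup>2 \<le> \<rho>" using \<rho> k by (auto simp: \<kappa>_def)
  obtain \<gamma> w where w: "\<gamma> > 0" "flat_weight \<kappa> \<gamma> w" "w 1 (-1) = 1"
    using exists_flat_weight[OF \<kappa>(1)] by blast
  obtain c N where c: "c > 0" and N: "\<And>n q. n \<ge> N \<Longrightarrow> n div (2 * k) \<ge> 1 \<and> (real q < exp (c * real n) \<longrightarrow>
     (real k + 4) * (1 + real q) * (4 * exp (- (\<gamma> * real (n div (2 * k)) / 4))) < \<epsilon> / 2)"
    using exponential_query_budget[of \<gamma> "\<epsilon> / 2" k] w assms by auto
  show thesis
  proof (rule that[OF c])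
    fix n q and R :: "'o algorithm pmf" and val
    assume n: "n \<ge> N" and q: "real q < exp (c * real n)"
      and out: "\<And>A f. A \<in> set_pmf R \<Longrightarrow> nonneg_submodular {..<n} f \<Longrightarrow>
        val (the (run A (val_oracle {..<n} f) q [])) \<in> polytope (exact_sets k (n div (2 * k)) n)"
    define m where "m = n div (2 * k)"
    have m: "m \<ge> 1" using N[OF n] by (simp add: m_def)
    have "2 * (k * m) \<le> n" using times_div_less_eq_dividend[of "2 * k" n] by (simp add: m_def mult.assoc)
    from hard_instance_exact_sets[OF k m this w(2,3) _ _ \<kappa>(2), of R val q] out \<kappa> w
    obtain f where f: "nonneg_submodular {..<n} f" "\<exists>S\<in>exact_sets k m n. 1 \<le> f S"
      "\<forall>S\<subseteq>{..<n}. f S \<le> real k + 4 * \<rho>"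
      "measure_pmf.expectation R (\<lambda>A. multilinear {..<n} f (val (the (run A (val_oracle {..<n} f) q []))))
      \<le> 1 / real k + 4 * \<rho> + (real k + 4 * \<rho>) * (1 + real q) * (4 * exp (- (\<gamma> * real m / 4)))"
      unfolding m_def by auto
    have "(real k + 4 * \<rho>) * (1 + real q) * (4 * exp (- (\<gamma> * real m / 4)))
        \<le> (real k + 4) * (1 + real q) * (4 * exp (- (\<gamma> * real m / 4)))"
      using \<rho> by (intro mult_right_mono) auto
    also have "\<dots> < \<epsilon> / 2" using N[OF n, of q] q by (simp add: m_def)
    finally show "\<exists>f b. nonneg_submodular {..<n} f \<and> (\<exists>S\<in>exact_sets k (n div (2 * k)) n. 1 \<le> f S) \<and>
        (\<forall>S\<subseteq>{..<n}. f S \<le> b) \<and>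
        measure_pmf.expectation R (\<lambda>A. multilinear {..<n} f (val (the (run A (val_oracle {..<n} f) q []))))
        < 1 / real k + \<epsilon>"
      using f \<rho> by (intro exI[of _ f] exI[of _ "real k + 4 * \<rho>"]) (auto simp: m_def)
  qed (use N in blast)
qed

text \<open>Separates the lower bound from the two notions of success: all it asks of
  \<open>succ\<close> is that outputs are feasible and that, on an instance with optimum at least 1,
  the expected value reaches \<open>1 / k + \<epsilon>\<close>.\<close>

lemma exp_hard_if_exact_sets:
  fixes \<epsilon> :: real
  assumes k: "k \<ge> 2" and "\<epsilon> > 0"
    and "Case": "\<And>m n. exact_sets k m n \<noteq> {} \<Longrightarrow> \<exists>I C col l u. Case {..<n} I C \<and>
      valid_structure {..<n} I C col l u \<and> feasible_sets {..<n} I C col l u = exact_sets k m n"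
    and succ: "\<And>n m f q R A. succ {..<n} (exact_sets k m n) f q R \<Longrightarrow> A \<in> set_pmf R \<Longrightarrow>
      val (the (run A (val_oracle {..<n} f) q [])) \<in> polytope (exact_sets k m n)"
    and gap: "\<And>n m f q R b S. succ {..<n} (exact_sets k m n) f q (R :: 'o algorithm pmf) \<Longrightarrow>
      S \<in> exact_sets k m n \<Longrightarrow> 1 \<le> f S \<Longrightarrow> (\<And>S. S \<subseteq> {..<n} \<Longrightarrow> f S \<le> b) \<Longrightarrow>
      1 / real k + \<epsilon> \<le> measure_pmf.expectation R (\<lambda>A. multilinear {..<n} f (val (the (run A (val_oracle {..<n} f) q []))))"
  shows "exp_hard Case (1 - 1 / real k) succ"
proof -
  obtain c N where c: "c > 0" and N: "\<And>n. n \<ge> N \<Longrightarrow> n div (2 * k) \<ge> 1"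
    and hard: "\<And>n q (R :: 'o algorithm pmf) val. n \<ge> N \<Longrightarrow> real q < exp (c * real n) \<Longrightarrow>
      (\<And>A f. A \<in> set_pmf R \<Longrightarrow> nonneg_submodular {..<n} f \<Longrightarrow>
        val (the (run A (val_oracle {..<n} f) q [])) \<in> polytope (exact_sets k (n div (2 * k)) n)) \<Longrightarrow>
      \<exists>f b. nonneg_submodular {..<n} f \<and> (\<exists>S\<in>exact_sets k (n div (2 * k)) n. 1 \<le> f S) \<and>
        (\<forall>S\<subseteq>{..<n}. f S \<le> b) \<and>
        measure_pmf.expectation R (\<lambda>A. multilinear {..<n} f (val (the (run A (val_oracle {..<n} f) q []))))
        < 1 / real k + \<epsilon>"
    using exact_sets_hard[OF k \<open>\<epsilon> > 0\<close>, where ?'o = 'o] by metis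
  have "\<exists>I C col l u. Case {..<n} I C \<and> valid_structure {..<n} I C col l u \<and>
       (let Fs = feasible_sets {..<n} I C col l u
        in (INF x\<in>polytope Fs \<union> one_minus {..<n} (polytope Fs). linf {..<n} x) \<le> 1 - 1 / real k \<and>
           (\<forall>q R. real q < exp (c * real n) \<longrightarrow>
              (\<forall>A\<in>set_pmf R. \<forall>f. nonneg_submodular {..<n} f \<longrightarrow> run A (val_oracle {..<n} f) q [] \<noteq> None) \<longrightarrow>
              (\<exists>f. nonneg_submodular {..<n} f \<and> \<not> succ {..<n} Fs f q R)))" if n: "n \<ge> N" for n
  proof -
    define m where "m = n div (2 * k)"
    have m: "m \<ge> 1" using N[OF n] by (simp add: m_def)
    have mn: "2 * (k * m) \<le> n" using times_div_less_eq_dividend[of "2 * k" n] by (simp add: m_def mult.assoc)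
    have "optimum k m (\<lambda>_. 0) \<in> exact_sets k m n" using k mn by (intro optimum_exact) auto
    then obtain I C col l u where "Case {..<n} I C" "valid_structure {..<n} I C col l u"
      and Fs: "feasible_sets {..<n} I C col l u = exact_sets k m n" using "Case" by blast
    moreover have "\<exists>f. nonneg_submodular {..<n} f \<and> \<not> succ {..<n} (exact_sets k m n) f q R"
      if q: "real q < exp (c * real n)" for q and R :: "'o algorithm pmf"
    proof (rule ccontr)
      assume "\<not> ?thesis"
      \<comment> \<open>Success on all instances supplies feasibility of the outputs on all
        instances, which is what \<open>hard\<close> assumes.\<close>
      then have all: "succ {..<n} (exact_sets k m n) f q R" if "nonneg_submodular {..<n} f" for f
        using that by blast
      then have "\<exists>f b. nonneg_submodular {..<n} f \<and> (\<exists>S\<in>exact_sets k m n. 1 \<le> f S) \<and> (\<forall>S\<subseteq>{..<n}. f S \<le> b) \<and>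
        measure_pmf.expectation R (\<lambda>A. multilinear {..<n} f (val (the (run A (val_oracle {..<n} f) q []))))
        < 1 / real k + \<epsilon>"
        using succ unfolding m_def by (intro hard n q) blast
      then obtain f b S where f: "nonneg_submodular {..<n} f" "S \<in> exact_sets k m n" "1 \<le> f S"
        "\<And>S. S \<subseteq> {..<n} \<Longrightarrow> f S \<le> b"
        "measure_pmf.expectation R (\<lambda>A. multilinear {..<n} f (val (the (run A (val_oracle {..<n} f) q []))))
        < 1 / real k + \<epsilon>" by blast
      from gap[OF all[OF f(1)] f(2,3,4)] f(5) show False by simp
    qed
    ultimately show ?thesis
      using INF_linf_le[OF k m mn] unfolding Let_def by (metis (no_types, lifting))
  qed
  with c show ?thesis unfolding exp_hard_def by blast
qed

lemma exp_hard_both: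
  fixes \<epsilon> :: real
  assumes k: "k \<ge> 2" and "\<epsilon> > 0"
    and "Case": "\<And>m n. exact_sets k m n \<noteq> {} \<Longrightarrow> \<exists>I C col l u. Case {..<n} I C \<and>
      valid_structure {..<n} I C col l u \<and> feasible_sets {..<n} I C col l u = exact_sets k m n"
  shows "exp_hard Case (1 - 1 / real k) (approx_disc (1 / real k + \<epsilon>))"
    and "exp_hard Case (1 - 1 / real k) (approx_cont (1 / real k + \<epsilon>))"
proof -
  let ?\<alpha> = "1 / real k + \<epsilon>"
  have \<alpha>: "?\<alpha> > 0" by (rule add_nonneg_pos) (use assms in auto)
  \<comment> \<open>The optimum is only known to be at least 1, so positivity of the ratio is used
    to drop it.\<close>
  have le: "?\<alpha> \<le> E" if "?\<alpha> * v \<le> E" "1 \<le> v" for v E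
  proof -
    have "?\<alpha> * 1 \<le> ?\<alpha> * v" using that(2) \<alpha> by (intro mult_left_mono) auto
    also note that(1)
    finally show ?thesis by simp
  qed
  show "exp_hard Case (1 - 1 / real k) (approx_disc ?\<alpha>)"
  proof (rule exp_hard_if_exact_sets[OF k \<open>\<epsilon> > 0\<close> "Case", where val = indic_vec])
    fix n m q f and R :: "nat set algorithm pmf"
    assume succ: "approx_disc ?\<alpha> {..<n} (exact_sets k m n) f q R"
    then show "indic_vec (the (run A (val_oracle {..<n} f) q [])) \<in> polytope (exact_sets k m n)"
      if "A \<in> set_pmf R" for A
      using that by (auto simp: approx_disc_def intro!: indic_vec_in_polytope finite_exact_sets)
    fix S assume S: "S \<in> exact_sets k m n" "1 \<le> f S"
    then have "1 \<le> Max (f ` exact_sets k m n)"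
      by (subst Max_ge_iff) (auto simp: finite_exact_sets)
    with succ have "?\<alpha> \<le> measure_pmf.expectation R (\<lambda>A. f (the (run A (val_oracle {..<n} f) q [])))"
      by (auto simp: approx_disc_def intro: le)
    also have "\<dots> = measure_pmf.expectation R
        (\<lambda>A. multilinear {..<n} f (indic_vec (the (run A (val_oracle {..<n} f) q []))))"
    proof (rule integral_cong_AE)
      show "AE A in measure_pmf R. f (the (run A (val_oracle {..<n} f) q []))
          = multilinear {..<n} f (indic_vec (the (run A (val_oracle {..<n} f) q [])))"
        using succ by (auto simp: AE_measure_pmf_iff approx_disc_def exact_sets_def multilinear_indic)
    qed auto
    finally show "?\<alpha> \<le> measure_pmf.expectation R
        (\<lambda>A. multilinear {..<n} f (indic_vec (the (run A (val_oracle {..<n} f) q []))))" .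
  qed
  show "exp_hard Case (1 - 1 / real k) (approx_cont ?\<alpha>)"
  proof (rule exp_hard_if_exact_sets[OF k \<open>\<epsilon> > 0\<close> "Case", where val = "\<lambda>x. x"])
    fix n m q f and R :: "(nat \<Rightarrow> real) algorithm pmf"
    assume succ: "approx_cont ?\<alpha> {..<n} (exact_sets k m n) f q R"
    then show "the (run A (val_oracle {..<n} f) q []) \<in> polytope (exact_sets k m n)"
      if "A \<in> set_pmf R" for A
      using that by (auto simp: approx_cont_def)
    fix S b assume S: "S \<in> exact_sets k m n" "1 \<le> f S" and b: "\<And>S. S \<subseteq> {..<n} \<Longrightarrow> f S \<le> b"
    have "multilinear {..<n} f x \<le> b" if "x \<in> polytope (exact_sets k m n)" for x
      using multilinear_mono[of "{..<n}" x f "\<lambda>_. b"] polytope_range[OF that] b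
      by (simp add: multilinear_const)
    then have "bdd_above (multilinear {..<n} f ` polytope (exact_sets k m n))"
      by (intro bdd_aboveI[of _ b]) auto
    then have "multilinear {..<n} f (indic_vec S) \<le> (SUP x\<in>polytope (exact_sets k m n). multilinear {..<n} f x)"
      using S(1) by (intro cSUP_upper indic_vec_in_polytope finite_exact_sets)
    moreover have "multilinear {..<n} f (indic_vec S) = f S"
      using S(1) by (intro multilinear_indic) (auto simp: exact_sets_def)
    ultimately show "?\<alpha> \<le> measure_pmf.expectation R
        (\<lambda>A. multilinear {..<n} f (the (run A (val_oracle {..<n} f) q [])))"
      using succ S(2) by (intro le[where v = "SUP x\<in>polytope (exact_sets k m n). multilinear {..<n} f x"])
        (auto simp: approx_cont_def)
  qed
qed

theorem theorem3p7:
  fixes t :: nat and \<epsilon> r :: real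
  assumes "t \<ge> 2" and "r = 1 - 1 / real t" and "\<epsilon> > 0"
  shows "exp_hard special_case_i r (approx_disc (1 - r + \<epsilon>))
       \<and> exp_hard special_case_i r (approx_cont (1 - r + \<epsilon>))
       \<and> exp_hard special_case_ii r (approx_disc (1 - r + \<epsilon>))
       \<and> exp_hard special_case_ii r (approx_cont (1 - r + \<epsilon>))"
proof -
  have "1 - r + \<epsilon> = 1 / real t + \<epsilon>" using assms(2) by simp
  then show ?thesis
    unfolding assms(2)
    using exp_hard_both[OF assms(1,3), of special_case_i] exp_hard_both[OF assms(1,3), of special_case_ii]
      special_case_i_exact_sets special_case_ii_exact_sets assms(1) by simp
qed

end
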